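(* Let $n\ge 2$, $s\ge 1$, and let $\Omega\subset\mathbb{R}^n$ be an $s$-John domain with central Whitney cube $Q_0$. Let $0<\varepsilon<1$, $1\le p\le n$ and $q\ge s(n-1)+1-p+\varepsilon$. Then there exists a positive constant $C=C(n,p,q,s,\varepsilon)$ such that $$\operatorname{Cap}_p(E,Q_0,\Omega)\ \ge\ C\,\Big(\mathcal{H}^q_\infty(E)\Big)^{\frac{s(n-1)+1-p+\varepsilon}{q}}$$ for every compact set $E\subset\Omega$ disjoint from $Q_0$.
   Context: **$s$-John domain.** For $s\ge 1$, a bounded domain $\Omega\subset\mathbb{R}^n$ is an $s$-John domain if there are a constant $C_0$ and a point $x_0\in\Omega$ (the John center) such that for each $x\in\Omega$ there is a rectifiable curve $\gamma:[0,1]\to\Omega$ with $\gamma(0)=x$, $\gamma(1)=x_0$ and $$C_0\, d(\gamma(t),\partial\Omega)\ge \big(l(\gamma([0,t]))\big)^s\quad\text{for each }0<t\le 1,$$ where $d(\cdot,\partial\Omega)$ is the distance to the boundary and $l$ denotes length. **Whitney decomposition and central cube.** A Whitney decomposition $\mathbb{W}$ of $\Omega$ is a collection of closed cubes $Q\subset\Omega$ with pairwise disjoint interiors and edges parallel to the coordinate axes, such that $\Omega=\bigcup_{Q\in\mathbb{W}}Q$, the diameters of the cubes belong to $\{2^{-j}:j\in\mathbb{Z}\}$, and $\operatorname{diam}(Q)\le\operatorname{dist}(Q,\partial\Omega)\le 4\operatorname{diam}(Q)$ for every $Q\in\mathbb{W}$. A Whitney decomposition of $\Omega$ is fixed, and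 the central Whitney cube $Q_0$ is the fixed Whitney cube containing the John center $x_0$. **Hausdorff content.** For $0<q<\infty$ and $E\subset\mathbb{R}^n$, $\mathcal{H}^q_\infty(E)=\inf\sum_i r_i^q$, where the infimum is over all coverings of $E$ by balls $B(x_i,r_i)$, $i=1,2,\dots$. **Capacity.** For disjoint compact sets $E,F\subset\Omega$, $\operatorname{Cap}_p(E,F,\Omega)=\inf_u\int_\Omega|\nabla u(x)|^p\,dx$, where the infimum is over all continuous functions $u\in W^{1,p}_{loc}(\Omega)$ with $u(x)\le 0$ for $x\in E$ and $u(x)\ge 1$ for $x\in F$. **Constants.** The domain $\Omega$ (with its John center, its $s$-John constant $C_0$, and its Whitney decomposition) is fixed before the constant $C$ is chosen; $C$ does not depend on $E$. *)

theory Defs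
  imports "HOL-Analysis.Analysis"
begin

definition bounded_domain :: "'a::euclidean_space set \<Rightarrow> bool" where
  "bounded_domain \<Omega> \<longleftrightarrow> open \<Omega> \<and> connected \<Omega> \<and> \<Omega> \<noteq> {} \<and> bounded \<Omega>"


section \<open>John domains\<close>

text \<open>Length of the subcurve of \<open>\<gamma>\<close> over \<open>[a, b]\<close>, counted with multiplicity:
  the supremum of the lengths of inscribed polygons.\<close>

definition curve_length :: "(real \<Rightarrow> 'a::metric_space) \<Rightarrow> real \<Rightarrow> real \<Rightarrow> ennreal" where
  "curve_length \<gamma> a b =
     (SUP (m, \<tau>) \<in> {(m::nat, \<tau>::nat \<Rightarrow> real).
          (\<forall>i\<le>m. \<tau> i \<in> {a..b}) \<and> (\<forall>i<m. \<tau> i \<le> \<tau> (Suc i))}.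
        \<Sum>i<m. ennreal (dist (\<gamma> (\<tau> i)) (\<gamma> (\<tau> (Suc i)))))"

definition rectifiable_path :: "(real \<Rightarrow> 'a::metric_space) \<Rightarrow> bool" where
  "rectifiable_path \<gamma> \<longleftrightarrow> path \<gamma> \<and> curve_length \<gamma> 0 1 < \<infinity>"

text \<open>Since \<open>\<gamma>\<close> is rectifiable, the lengths below are finite and \<^const>\<open>enn2real\<close> loses nothing.\<close>

definition s_John_domain ::
    "real \<Rightarrow> real \<Rightarrow> 'a::euclidean_space \<Rightarrow> 'a set \<Rightarrow> bool" where
  "s_John_domain s C\<^sub>0 x\<^sub>0 \<Omega> \<longleftrightarrow>
     bounded_domain \<Omega> \<and> 0 < C\<^sub>0 \<and> x\<^sub>0 \<in> \<Omega> \<and>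
     (\<forall>x\<in>\<Omega>. \<exists>\<gamma>. rectifiable_path \<gamma> \<and> path_image \<gamma> \<subseteq> \<Omega> \<and>
        pathstart \<gamma> = x \<and> pathfinish \<gamma> = x\<^sub>0 \<and>
        (\<forall>t. 0 < t \<and> t \<le> 1 \<longrightarrow>
           C\<^sub>0 * infdist (\<gamma> t) (frontier \<Omega>) \<ge> enn2real (curve_length \<gamma> 0 t) powr s))"


section \<open>Whitney decompositions\<close>

definition axis_parallel_cube :: "'a::euclidean_space set \<Rightarrow> bool" where
  "axis_parallel_cube Q \<longleftrightarrow> (\<exists>a l. 0 < l \<and> Q = cbox a (a + l *\<^sub>R One))"

definition whitney_decomposition ::
    "'a::euclidean_space set \<Rightarrow> 'a set set \<Rightarrow> bool" where
  "whitney_decomposition \<Omega> W \<longleftrightarrow>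
     (\<forall>Q\<in>W. axis_parallel_cube Q) \<and>
     (\<forall>Q\<in>W. \<forall>R\<in>W. Q \<noteq> R \<longrightarrow> interior Q \<inter> interior R = {}) \<and>
     \<Union>W = \<Omega> \<and>
     (\<forall>Q\<in>W. \<exists>j::int. diameter Q = 2 powi (- j)) \<and>
     (\<forall>Q\<in>W. diameter Q \<le> setdist Q (frontier \<Omega>) \<and>
             setdist Q (frontier \<Omega>) \<le> 4 * diameter Q)"


section \<open>Hausdorff content\<close>

definition hausdorff_content :: "real \<Rightarrow> 'a::metric_space set \<Rightarrow> ennreal" where
  "hausdorff_content q E =
     (INF (x, r) \<in> {(x::nat \<Rightarrow> 'a, r::nat \<Rightarrow> real).
          (\<forall>i. 0 < r i) \<and> E \<subseteq> (\<Union>i. ball (x i) (r i))}.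
        \<Sum>i. ennreal (r i powr q))"

lemma hausdorff_content_finite:
  fixes E :: "'a::metric_space set"
  assumes "bounded E" "0 < q"
  shows "hausdorff_content q E < \<infinity>"
proof -
  obtain x :: 'a and R where R: "0 < R" "E \<subseteq> ball x R"
    using assms(1) by (metis bounded_subset_ballD)
  define r where "r i = R * (1/2) ^ i" for i :: nat
  have "E \<subseteq> ball x (r 0)"
    using R by (simp add: r_def)
  then have cov: "E \<subseteq> (\<Union>i. ball x (r i))"
    by blast
  have pos: "0 < r i" for i
    using R by (simp add: r_def)
  have eq: "r i powr q = R powr q * ((1/2) powr q) ^ i" for i
    using R by (simp add: r_def powr_mult powr_power flip: powr_realpow)
      (simp add: powr_powr mult.commute)
  have "(1/2::real) powr q < 1"
    using powr_less_mono2[of q "1/2" 1] assms(2) by simp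
  then have "summable (\<lambda>i. r i powr q)"
    unfolding eq by (intro summable_mult summable_geometric) simp
  then have fin: "(\<Sum>i. ennreal (r i powr q)) < \<infinity>"
    by (simp add: suminf_ennreal2)
  have "hausdorff_content q E \<le> (\<Sum>i. ennreal (r i powr q))"
    unfolding hausdorff_content_def using pos cov
    by (intro INF_lower2[where i = "(\<lambda>_. x, r)"]) auto
  then show ?thesis
    using fin by (rule le_less_trans)
qed


section \<open>Local Sobolev spaces and capacity\<close>

primrec C_k :: "nat \<Rightarrow> ('a::euclidean_space \<Rightarrow> real) \<Rightarrow> bool" where
  "C_k 0 f \<longleftrightarrow> continuous_on UNIV f"
| "C_k (Suc k) f \<longleftrightarrow> (\<forall>x. f differentiable (at x)) \<and>
     (\<forall>b\<in>Basis. C_k k (\<lambda>x. frechet_derivative f (at x) b))"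

definition test_function :: "'a::euclidean_space set \<Rightarrow> ('a \<Rightarrow> real) \<Rightarrow> bool" where
  "test_function \<Omega> \<phi> \<longleftrightarrow>
     (\<forall>k. C_k k \<phi>) \<and> compact (closure {x. \<phi> x \<noteq> 0}) \<and> closure {x. \<phi> x \<noteq> 0} \<subseteq> \<Omega>"

definition Lp_loc ::
    "real \<Rightarrow> 'a::euclidean_space set \<Rightarrow> ('a \<Rightarrow> 'b::euclidean_space) \<Rightarrow> bool" where
  "Lp_loc p \<Omega> f \<longleftrightarrow>
     (\<forall>K. compact K \<and> K \<subseteq> \<Omega> \<longrightarrow>
        set_borel_measurable lebesgue K f \<and>
        set_integrable lebesgue K (\<lambda>x. norm (f x) powr p))"

definition weak_gradient ::
    "'a::euclidean_space set \<Rightarrow> ('a \<Rightarrow> real) \<Rightarrow> ('a \<Rightarrow> 'a) \<Rightarrow> bool" where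
  "weak_gradient \<Omega> u g \<longleftrightarrow>
     Lp_loc 1 \<Omega> u \<and> Lp_loc 1 \<Omega> g \<and>
     (\<forall>\<phi>. test_function \<Omega> \<phi> \<longrightarrow> (\<forall>b\<in>Basis.
        (LINT x:\<Omega>|lebesgue. u x * frechet_derivative \<phi> (at x) b) =
        - (LINT x:\<Omega>|lebesgue. (g x \<bullet> b) * \<phi> x)))"

definition W1p_loc :: "real \<Rightarrow> 'a::euclidean_space set \<Rightarrow> ('a \<Rightarrow> real) set" where
  "W1p_loc p \<Omega> = {u. Lp_loc p \<Omega> u \<and> (\<exists>g. weak_gradient \<Omega> u g \<and> Lp_loc p \<Omega> g)}"

text \<open>The weak gradient \<open>g\<close> of \<open>u\<close> is unique up to null sets, so the integral depends on \<open>u\<close> only.\<close>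

definition Cap ::
    "real \<Rightarrow> 'a::euclidean_space set \<Rightarrow> 'a set \<Rightarrow> 'a set \<Rightarrow> ennreal" where
  "Cap p E F \<Omega> =
     (INF (u, g) \<in> {(u, g). continuous_on \<Omega> u \<and> u \<in> W1p_loc p \<Omega> \<and> weak_gradient \<Omega> u g \<and>
          (\<forall>x\<in>E. u x \<le> 0) \<and> (\<forall>x\<in>F. 1 \<le> u x)}.
        \<integral>\<^sup>+x\<in>\<Omega>. ennreal (norm (g x) powr p) \<partial>lebesgue)"

end

theory Submission
  imports Defs
begin

text \<open>
  Let \<open>u\<close> be admissible with weak gradient \<open>g\<close> and \<open>x \<in> E\<close>; write \<open>n\<close> for the dimension and
  \<open>\<alpha> = s (n - 1) + 1 - p + \<epsilon>\<close>. Follow the John curve from \<open>x\<close> and cut it where its length passes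
  \<open>R\<^sub>k = R / 2 ^ k\<close>. On the \<open>k\<close>-th piece the distance to the boundary is at least a multiple of
  \<open>R\<^sub>k powr s\<close>, so averages of \<open>u\<close> over balls of the fixed radius \<open>\<rho>\<^sub>k = c R\<^sub>k powr s\<close> can be compared
  along the piece. A \<open>\<rho>\<^sub>k\<close>-separated subset of it has at most \<open>3 R\<^sub>k / \<rho>\<^sub>k\<close> points, whence by the
  elementary inequality \<open>t \<le> \<kappa> + \<kappa> powr (1 - p) * t powr p\<close> (in place of Hoelder's) the average changes by
  at most a multiple of \<open>\<kappa> R\<^sub>k + \<kappa> powr (1 - p) \<rho>\<^sub>k powr (1 - n) G\<^sub>k\<close> for every \<open>\<kappa> > 0\<close>, where \<open>G\<^sub>k\<close> is
  the energy in the ball of radius \<open>4 R\<^sub>k\<close> about \<open>x\<close>. If \<open>G\<^sub>k < \<delta> R\<^sub>k powr \<alpha>\<close> for all \<open>k\<close> with \<open>\<delta>\<close> small,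
  these changes sum to less than one half, contradicting \<open>u x \<le> 0\<close> and \<open>u \<ge> 1\<close> on \<open>Q\<^sub>0\<close>. Hence every
  point of \<open>E\<close> is the centre of a ball whose energy is at least a multiple of the \<open>\<alpha>\<close>-th power of its
  radius, and Vitali's covering lemma concludes.
\<close>

section \<open>A smooth kernel\<close>

text \<open>\<open>pexp 0\<close> is the classical flat smooth function. The index keeps the family
  closed under differentiation up to linear combinations, so that one derivative formula yields
  derivatives of every order.\<close>

definition pexp :: "nat \<Rightarrow> real \<Rightarrow> real" where
  "pexp k x = (if 0 < x then exp (- 1 / x) / x ^ k else 0)"

lemma pexp_tendsto_0: "((\<lambda>x. exp (- 1 / x) / x ^ k) \<longlongrightarrow> (0::real)) (at_right 0)"
proof -
  have "((\<lambda>y. y ^ k / exp y) \<longlongrightarrow> (0::real)) at_top"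
    by (rule tendsto_power_div_exp_0)
  then show ?thesis
    unfolding filterlim_at_right_to_top
    by (simp add: exp_minus field_simps power_inverse)
qed

lemma pexp_has_real_derivative:
  "(pexp k has_real_derivative (pexp (k + 2) x - real k * pexp (k + 1) x)) (at x)"
proof -
  consider "x < 0" | "x = 0" | "0 < x" by linarith
  then show ?thesis
  proof cases
    case 1
    have "((\<lambda>_. 0) has_real_derivative 0) (at x)" by simp
    then have "(pexp k has_real_derivative 0) (at x)"
      by (rule has_field_derivative_transform_within_open[where S = "{..<0}"])
        (use 1 in \<open>auto simp: pexp_def\<close>)
    then show ?thesis using 1 by (simp add: pexp_def)
  next
    case 3
    have "((\<lambda>x. exp (- 1 / x) / x ^ k) has_real_derivative
        (exp (- 1 / x) * (1 / x\<^sup>2) * x ^ k - exp (- 1 / x) * (real k * x ^ (k - 1))) / (x ^ k)\<^sup>2) (at x)"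
      using 3 by (auto intro!: derivative_eq_intros simp: power2_eq_square)
    then have "(pexp k has_real_derivative
        (exp (- 1 / x) * (1 / x\<^sup>2) * x ^ k - exp (- 1 / x) * (real k * x ^ (k - 1))) / (x ^ k)\<^sup>2) (at x)"
      by (rule has_field_derivative_transform_within_open[where S = "{0<..}"])
        (use 3 in \<open>auto simp: pexp_def\<close>)
    moreover have "(exp (- 1 / x) * (1 / x\<^sup>2) * x ^ k - exp (- 1 / x) * (real k * x ^ (k - 1))) / (x ^ k)\<^sup>2
        = pexp (k + 2) x - real k * pexp (k + 1) x"
      using 3 by (cases k) (simp_all add: pexp_def field_simps power2_eq_square)
    ultimately show ?thesis by simp
  next
    case 2
    have "((\<lambda>y. (pexp k y - pexp k 0) / (y - 0)) \<longlongrightarrow> 0) (at 0)"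
    proof (rule filterlim_split_at)
      show "((\<lambda>y. (pexp k y - pexp k 0) / (y - 0)) \<longlongrightarrow> 0) (at_left 0)"
        by (rule tendsto_eventually) (auto simp: eventually_at_filter pexp_def)
      \<comment> \<open>The right difference quotient of \<open>pexp k\<close> at 0 is the same kind
        of expression with index \<open>Suc k\<close>.\<close>
      have "((\<lambda>x. exp (- 1 / x) / x ^ Suc k) \<longlongrightarrow> (0::real)) (at_right 0)"
        by (rule pexp_tendsto_0)
      then show "((\<lambda>y. (pexp k y - pexp k 0) / (y - 0)) \<longlongrightarrow> 0) (at_right 0)"
        by (rule Lim_transform_eventually) (auto simp: eventually_at_filter pexp_def)
    qed
    then show ?thesis
      using 2 by (simp add: has_field_derivative_iff pexp_def)
  qed
qed

lemma continuous_on_pexp [continuous_intros]: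
  "continuous_on A f \<Longrightarrow> continuous_on A (\<lambda>x. pexp k (f x))"
  by (rule continuous_on_compose2[of UNIV "pexp k"])
    (auto intro!: continuous_at_imp_continuous_on DERIV_isCont pexp_has_real_derivative)

lemma pexp_0_bounds: "0 \<le> pexp 0 x" "pexp 0 x \<le> 1"
  by (auto simp: pexp_def)

text \<open>An algebra of functions closed under partial derivatives; all its members are smooth.\<close>

inductive pexp_algebra :: "('a::euclidean_space \<Rightarrow> real) \<Rightarrow> bool" where
  const: "pexp_algebra (\<lambda>_. c)"
| inner: "pexp_algebra (\<lambda>y. y \<bullet> b)"
| add: "pexp_algebra f \<Longrightarrow> pexp_algebra g \<Longrightarrow> pexp_algebra (\<lambda>y. f y + g y)"
| mult: "pexp_algebra f \<Longrightarrow> pexp_algebra g \<Longrightarrow> pexp_algebra (\<lambda>y. f y * g y)"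
| pexp: "pexp_algebra f \<Longrightarrow> pexp_algebra (\<lambda>y. pexp k (f y))"

lemma pexp_algebra_diff:
  assumes "pexp_algebra f" "pexp_algebra g" shows "pexp_algebra (\<lambda>y. f y - g y)"
  using pexp_algebra.add[OF assms(1) pexp_algebra.mult[OF pexp_algebra.const[of "-1"] assms(2)]]
  by simp

lemma pexp_algebra_sum:
  "(\<And>i. i \<in> I \<Longrightarrow> pexp_algebra (f i)) \<Longrightarrow> pexp_algebra (\<lambda>y. \<Sum>i\<in>I. f i y)"
  by (induction I rule: infinite_finite_induct) (auto intro: pexp_algebra.intros)

lemma pexp_algebra_has_derivative:
  assumes "pexp_algebra f"
  shows "\<exists>D. (\<forall>x. (f has_derivative D x) (at x)) \<and> (\<forall>b. pexp_algebra (\<lambda>x. D x b))"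
  using assms
proof induction
  case (const c)
  then show ?case by (intro exI[of _ "\<lambda>_ _. 0"]) (auto intro: pexp_algebra.const)
next
  case (inner b)
  then show ?case
    by (intro exI[of _ "\<lambda>_ h. h \<bullet> b"]) (auto intro!: pexp_algebra.const derivative_eq_intros)
next
  case (add f g)
  then obtain D1 D2 where "\<forall>x. (f has_derivative D1 x) (at x)" "\<forall>b. pexp_algebra (\<lambda>x. D1 x b)"
    "\<forall>x. (g has_derivative D2 x) (at x)" "\<forall>b. pexp_algebra (\<lambda>x. D2 x b)" by blast
  then show ?case
    by (intro exI[of _ "\<lambda>x h. D1 x h + D2 x h"])
      (auto intro: pexp_algebra.add intro!: derivative_eq_intros)
next
  case (mult f g)
  then obtain D1 D2 where *: "\<forall>x. (f has_derivative D1 x) (at x)" "\<forall>b. pexp_algebra (\<lambda>x. D1 x b)"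
    "\<forall>x. (g has_derivative D2 x) (at x)" "\<forall>b. pexp_algebra (\<lambda>x. D2 x b)" by blast
  show ?case
  proof (intro exI[of _ "\<lambda>x h. f x * D2 x h + D1 x h * g x"] conjI allI)
    show "((\<lambda>y. f y * g y) has_derivative (\<lambda>h. f x * D2 x h + D1 x h * g x)) (at x)" for x
      using * by (auto intro!: has_derivative_mult)
    show "pexp_algebra (\<lambda>x. f x * D2 x b + D1 x b * g x)" for b
      using * mult.hyps by (auto intro!: pexp_algebra.add pexp_algebra.mult)
  qed
next
  case (pexp f k)
  then obtain D where *: "\<forall>x. (f has_derivative D x) (at x)" "\<forall>b. pexp_algebra (\<lambda>x. D x b)"
    by blast
  define P where "P x = pexp (k + 2) (f x) - real k * pexp (k + 1) (f x)" for x
  have P: "pexp_algebra P"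
    unfolding P_def using pexp.hyps
    by (auto intro!: pexp_algebra_diff pexp_algebra.mult intro: pexp_algebra.intros)
  show ?case
  proof (intro exI[of _ "\<lambda>x h. D x h * P x"] conjI allI)
    show "((\<lambda>y. pexp k (f y)) has_derivative (\<lambda>h. D x h * P x)) (at x)" for x
    proof -
      have "(f has_derivative D x) (at x)" using * by blast
      from DERIV_compose_FDERIV[OF pexp_has_real_derivative this]
      show ?thesis by (simp add: P_def)
    qed
    show "pexp_algebra (\<lambda>x. D x b * P x)" for b
      using * P by (intro pexp_algebra.mult) auto
  qed
qed

lemma pexp_algebra_C_k: "pexp_algebra f \<Longrightarrow> C_k k f"
proof (induction k arbitrary: f)
  case 0
  then obtain D where "\<forall>x. (f has_derivative D x) (at x)"
    using pexp_algebra_has_derivative by blast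
  then show ?case
    by (auto intro!: continuous_at_imp_continuous_on dest: has_derivative_continuous)
next
  case (Suc k)
  then obtain D where D: "\<forall>x. (f has_derivative D x) (at x)" "\<forall>b. pexp_algebra (\<lambda>x. D x b)"
    using pexp_algebra_has_derivative by blast
  then have "frechet_derivative f (at x) = D x" for x
    using frechet_derivative_at by metis
  then show ?case
    using D Suc.IH by (auto simp: differentiable_def)
qed

text \<open>Not normalised: the integral is some positive constant independent of \<open>a\<close> and \<open>r\<close>.\<close>

definition mol :: "'a::euclidean_space \<Rightarrow> real \<Rightarrow> 'a \<Rightarrow> real" where
  "mol a r y = pexp 0 (1 - (y - a) \<bullet> (y - a) / r\<^sup>2) / r ^ DIM('a)"

lemma mol_bounds:
  assumes "0 < r" shows "0 \<le> mol a r (y::'a)" "mol a r (y::'a::euclidean_space) \<le> 1 / r ^ DIM('a)"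
  using assms pexp_0_bounds by (auto simp: mol_def intro!: divide_right_mono)

lemma mol_eq_0:
  assumes "0 < r" "y \<notin> ball a r" shows "mol a r y = 0"
proof -
  have "r \<le> norm (y - a)" using assms by (simp add: dist_norm norm_minus_commute)
  then have "r\<^sup>2 \<le> (y - a) \<bullet> (y - a)" using assms by (simp add: power2_norm_eq_inner[symmetric] power_mono)
  then show ?thesis using assms by (simp add: mol_def pexp_def field_simps)
qed

lemma mol_continuous [continuous_intros]:
  assumes "continuous_on A a" "continuous_on A r" "continuous_on A y" "\<And>x. x \<in> A \<Longrightarrow> r x \<noteq> 0"
  shows "continuous_on A (\<lambda>x. mol (a x) (r x) (y x))"
  unfolding mol_def using assms by (intro continuous_intros) auto

text \<open>The algebra is generated from linear functions, so the squared distance is expanded in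
  coordinates.\<close>

lemma pexp_algebra_inner_self: "pexp_algebra (\<lambda>y. (y - a) \<bullet> (y - a))"
proof -
  have "pexp_algebra (\<lambda>y. \<Sum>b\<in>Basis. (y \<bullet> b - a \<bullet> b) * (y \<bullet> b - a \<bullet> b))"
    by (intro pexp_algebra_sum pexp_algebra.mult pexp_algebra_diff pexp_algebra.inner pexp_algebra.const)
  moreover have "(y - a) \<bullet> (y - a) = (\<Sum>b\<in>Basis. (y \<bullet> b - a \<bullet> b) * (y \<bullet> b - a \<bullet> b))" for y
    by (subst euclidean_inner) (simp only: inner_diff_left)
  ultimately show ?thesis by (simp only:)
qed

lemma pexp_algebra_mol: "pexp_algebra (mol a r)"
proof -
  have "pexp_algebra (\<lambda>y. (1 / r ^ DIM('a)) * pexp 0 (1 - (1 / r\<^sup>2) * ((y - a) \<bullet> (y - a))))"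
    by (intro pexp_algebra.mult pexp_algebra.pexp pexp_algebra_diff pexp_algebra.const
        pexp_algebra_inner_self)
  then show ?thesis by (simp add: mol_def[abs_def])
qed

section \<open>Derivatives of the kernel in space and in time\<close>

text \<open>Components of a cut-off affine field; these are the test functions inserted into the
  definition of the weak gradient.\<close>

lemma test_function_field_mol:
  assumes "0 < r" "cball a r \<subseteq> \<Omega>"
  shows "test_function \<Omega> (\<lambda>y. ((v + \<rho> *\<^sub>R (y - a)) \<bullet> b) * mol a r y)"
proof -
  have "pexp_algebra (\<lambda>y. (v \<bullet> b + \<rho> * (y \<bullet> b - a \<bullet> b)) * mol a r y)"
    by (intro pexp_algebra.mult pexp_algebra.add pexp_algebra_diff pexp_algebra.const
        pexp_algebra.inner pexp_algebra_mol)
  then have "C_k k (\<lambda>y. ((v + \<rho> *\<^sub>R (y - a)) \<bullet> b) * mol a r y)" for k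
    by (intro pexp_algebra_C_k) (simp add: inner_simps)
  moreover have "{x. ((v + \<rho> *\<^sub>R (x - a)) \<bullet> b) * mol a r x \<noteq> 0} \<subseteq> cball a r"
    using mol_eq_0[OF assms(1)] ball_subset_cball by fastforce
  then have "closure {x. ((v + \<rho> *\<^sub>R (x - a)) \<bullet> b) * mol a r x \<noteq> 0} \<subseteq> cball a r"
    by (intro closure_minimal) auto
  ultimately show ?thesis
    using assms(2)
    unfolding test_function_def
    by (metis (no_types, lifting) bounded_cball bounded_subset closed_closure compact_eq_bounded_closed subset_trans)
qed

text \<open>\<open>pexp 2\<close> appears as the derivative of \<open>pexp 0\<close>: the term with
  index \<open>k + 1\<close> carries the factor \<open>k = 0\<close>.\<close>

lemma field_mol_has_derivative:
  fixes a v b :: "'a::euclidean_space"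
  assumes "0 < r"
  shows "((\<lambda>y. ((v + \<rho> *\<^sub>R (y - a)) \<bullet> b) * mol a r y) has_derivative
    (\<lambda>h. \<rho> * (h \<bullet> b) * mol a r y - ((v + \<rho> *\<^sub>R (y - a)) \<bullet> b) *
       (2 * (h \<bullet> (y - a)) * pexp 2 (1 - (y - a) \<bullet> (y - a) / r\<^sup>2) / r ^ (DIM('a) + 2)))) (at y)"
proof -
  have d: "((\<lambda>y. 1 - (y - a) \<bullet> (y - a) / r\<^sup>2) has_derivative (\<lambda>h. - (2 * (h \<bullet> (y - a)) / r\<^sup>2))) (at y)"
    using assms
    by (auto intro!: derivative_eq_intros
        simp: inner_commute fun_eq_iff field_simps power2_eq_square power4_eq_xxxx)
  have "((\<lambda>y. pexp 0 (1 - (y - a) \<bullet> (y - a) / r\<^sup>2)) has_derivative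
     (\<lambda>h. - (2 * (h \<bullet> (y - a)) / r\<^sup>2) * pexp 2 (1 - (y - a) \<bullet> (y - a) / r\<^sup>2))) (at y)"
    using DERIV_compose_FDERIV[OF pexp_has_real_derivative[of 0] d] by (simp add: numeral_2_eq_2)
  then show ?thesis
    unfolding mol_def using assms
    by (auto intro!: derivative_eq_intros simp: inner_simps field_simps power2_eq_square)
qed

text \<open>The first term differentiates the normalisation \<open>1 / R ^ n\<close>, the second the
  argument of \<open>pexp 0\<close>. Grouping the velocity as
  \<open>v + (\<rho> / R) *\<^sub>R w\<close> prepares the comparison with the spatial derivatives
  of the cut-off field.\<close>

lemma mol_has_real_derivative:
  fixes a v y :: "'a::euclidean_space"
  assumes "0 < r + t * \<rho>"
  defines "w \<equiv> y - (a + t *\<^sub>R v)" and "R \<equiv> r + t * \<rho>"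
  shows "((\<lambda>t. mol (a + t *\<^sub>R v) (r + t * \<rho>) y) has_real_derivative
    (- real DIM('a) * \<rho> / R * mol (a + t *\<^sub>R v) R y +
      2 * (w \<bullet> (v + (\<rho> / R) *\<^sub>R w)) * pexp 2 (1 - w \<bullet> w / R\<^sup>2) / R ^ (DIM('a) + 2))) (at t)"
proof -
  have R: "0 < R" using assms by simp
  have d: "((\<lambda>t. 1 - (y - (a + t *\<^sub>R v)) \<bullet> (y - (a + t *\<^sub>R v)) / (r + t * \<rho>)\<^sup>2) has_real_derivative
      2 * (w \<bullet> (v + (\<rho> / R) *\<^sub>R w)) / R\<^sup>2) (at t)"
  proof -
    have d1: "((\<lambda>t. (y - (a + t *\<^sub>R v)) \<bullet> (y - (a + t *\<^sub>R v))) has_real_derivative - 2 * (w \<bullet> v)) (at t)"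
      unfolding has_field_derivative_def w_def
      by (auto intro!: derivative_eq_intros simp: inner_simps inner_commute algebra_simps)
    have d2: "((\<lambda>t. (r + t * \<rho>)\<^sup>2) has_real_derivative 2 * R * \<rho>) (at t)"
      unfolding R_def by (auto intro!: derivative_eq_intros)
    have "((\<lambda>t. 1 - (y - (a + t *\<^sub>R v)) \<bullet> (y - (a + t *\<^sub>R v)) / (r + t * \<rho>)\<^sup>2) has_real_derivative
        0 - ((- 2 * (w \<bullet> v)) * R\<^sup>2 - (w \<bullet> w) * (2 * R * \<rho>)) / (R\<^sup>2 * R\<^sup>2)) (at t)"
      using R by (intro DERIV_cong[OF DERIV_diff[OF DERIV_const DERIV_divide[OF d1 d2]]])
        (use assms(1) in \<open>simp_all flip: R_def w_def\<close>)
    moreover have "0 - ((- 2 * (w \<bullet> v)) * R\<^sup>2 - (w \<bullet> w) * (2 * R * \<rho>)) / (R\<^sup>2 * R\<^sup>2)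
        = 2 * (w \<bullet> (v + (\<rho> / R) *\<^sub>R w)) / R\<^sup>2"
      using R by (simp add: inner_simps field_simps power2_eq_square)
    ultimately show ?thesis by simp
  qed
  have "((\<lambda>t. pexp 0 (1 - (y - (a + t *\<^sub>R v)) \<bullet> (y - (a + t *\<^sub>R v)) / (r + t * \<rho>)\<^sup>2)) has_real_derivative
      pexp 2 (1 - w \<bullet> w / R\<^sup>2) * (2 * (w \<bullet> (v + (\<rho> / R) *\<^sub>R w)) / R\<^sup>2)) (at t)"
    using DERIV_chain2[OF pexp_has_real_derivative[of 0] d] by (simp add: numeral_2_eq_2 w_def R_def)
  then have "((\<lambda>t. mol (a + t *\<^sub>R v) (r + t * \<rho>) y) has_real_derivative
      (pexp 2 (1 - w \<bullet> w / R\<^sup>2) * (2 * (w \<bullet> (v + (\<rho> / R) *\<^sub>R w)) / R\<^sup>2) * R ^ DIM('a) -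
       pexp 0 (1 - w \<bullet> w / R\<^sup>2) * (real DIM('a) * R ^ (DIM('a) - 1) * \<rho>)) / (R ^ DIM('a) * R ^ DIM('a))) (at t)"
    unfolding mol_def using R unfolding R_def w_def by (auto intro!: derivative_eq_intros)
  moreover obtain m where m: "DIM('a) = Suc m"
    using DIM_positive[where 'a = 'a] gr0_implies_Suc by blast
  have "(pexp 2 (1 - w \<bullet> w / R\<^sup>2) * (2 * (w \<bullet> (v + (\<rho> / R) *\<^sub>R w)) / R\<^sup>2) * R ^ DIM('a) -
       pexp 0 (1 - w \<bullet> w / R\<^sup>2) * (real DIM('a) * R ^ (DIM('a) - 1) * \<rho>)) / (R ^ DIM('a) * R ^ DIM('a))
     = (- real DIM('a) * \<rho> / R * mol (a + t *\<^sub>R v) R y +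
      2 * (w \<bullet> (v + (\<rho> / R) *\<^sub>R w)) * pexp 2 (1 - w \<bullet> w / R\<^sup>2) / R ^ (DIM('a) + 2))"
    using R unfolding mol_def m by (simp add: w_def[symmetric] field_simps power2_eq_square)
  ultimately show ?thesis by simp
qed

section \<open>Mollified averages\<close>

text \<open>There is no division by the mass of the kernel: by \<open>integral_mol\<close> that mass
  is the same for all balls, and it is carried along in the bounds.\<close>

definition avg :: "'a::euclidean_space set \<Rightarrow> ('a \<Rightarrow> real) \<Rightarrow> 'a \<Rightarrow> real \<Rightarrow> real" where
  "avg \<Omega> u a r = (LINT y:\<Omega>|lebesgue. u y * mol a r y)"

text \<open>A bridge between two integrals: \<open>u\<close> is only continuous on \<Omega>, whereas
  differentiation under the integral sign is applied to a continuous integrand on a box. Since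
  \<open>f\<close> vanishes outside \<open>K\<close>, replacing \<open>u\<close> by a continuous
  extension \<open>u'\<close> does not change the value.\<close>

lemma set_integral_continuous_compact_support:
  fixes f u u' :: "'a::euclidean_space \<Rightarrow> real"
  assumes "K \<subseteq> \<Omega>" "K \<subseteq> cbox c d" "continuous_on UNIV u'" "continuous_on UNIV f"
    and eq: "\<And>x. x \<in> K \<Longrightarrow> u' x = u x" and zero: "\<And>x. x \<notin> K \<Longrightarrow> f x = 0"
  shows "set_integrable lebesgue \<Omega> (\<lambda>x. u x * f x)"
    and "(LINT x:\<Omega>|lebesgue. u x * f x) = integral (cbox c d) (\<lambda>x. u' x * f x)"
proof -
  have "continuous_on (cbox c d) (\<lambda>x. u' x * f x)"
    by (intro continuous_intros continuous_on_subset[OF assms(3)] continuous_on_subset[OF assms(4)]) auto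
  then have int: "set_integrable lebesgue (cbox c d) (\<lambda>x. u' x * f x)"
    by (rule absolutely_integrable_continuous)
  have *: "indicator \<Omega> x *\<^sub>R (u x * f x) = indicator (cbox c d) x *\<^sub>R (u' x * f x)" for x
    using assms(1,2) eq[of x] zero[of x] by (cases "x \<in> K") (auto simp: indicator_def)
  show "set_integrable lebesgue \<Omega> (\<lambda>x. u x * f x)"
    using int unfolding set_integrable_def * .
  show "(LINT x:\<Omega>|lebesgue. u x * f x) = integral (cbox c d) (\<lambda>x. u' x * f x)"
    using set_lebesgue_integral_eq_integral(2)[OF int] unfolding set_lebesgue_integral_def * .
qed

lemma compact_continuous_extension:
  fixes u :: "'a::euclidean_space \<Rightarrow> real"
  assumes "compact K" "continuous_on K u"
  obtains u' c d where "continuous_on UNIV u'" "\<And>x. x \<in> K \<Longrightarrow> u' x = u x" "K \<subseteq> cbox c d"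
proof -
  obtain u' where "continuous_on UNIV u'" "\<And>x. x \<in> K \<Longrightarrow> u' x = u x"
    using Tietze_unbounded[OF assms(2), of UNIV] closed_subset[OF subset_UNIV compact_imp_closed[OF assms(1)]]
    by blast
  moreover obtain c where "K \<subseteq> cbox (- c) c"
    using bounded_subset_cbox_symmetric[OF compact_imp_bounded[OF assms(1)]] by blast
  ultimately show ?thesis using that by blast
qed

lemma mol_eq_0_outside:
  "0 < r \<Longrightarrow> cball a r \<subseteq> K \<Longrightarrow> y \<notin> K \<Longrightarrow> mol a r y = 0"
  using ball_subset_cball[of a r] by (intro mol_eq_0) blast+

lemma mol_continuous_on_UNIV: "0 < r \<Longrightarrow> continuous_on UNIV (mol a r)"
  by (intro continuous_intros) auto

lemma integrable_mol:
  assumes "0 < r" shows "integrable lebesgue (mol a r)"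
proof -
  obtain c where c: "cball a r \<subseteq> cbox (- c) c"
    using bounded_subset_cbox_symmetric[OF bounded_cball] by blast
  have "set_integrable lebesgue UNIV (\<lambda>x. 1 * mol a r x)"
    using c mol_continuous_on_UNIV[OF assms, of a] mol_eq_0_outside[OF assms order_refl, of _ a]
    by (intro set_integral_continuous_compact_support(1)[where K = "cball a r" and u' = "\<lambda>_. 1" and c = "-c" and d = c])
      auto
  then show ?thesis by (simp add: set_integrable_def)
qed

text \<open>Substitution of \<open>a + r *\<^sub>R y\<close>; its Jacobian
  \<open>r ^ DIM('a)\<close> cancels the normalisation of the kernel.\<close>

lemma integral_mol:
  fixes a :: "'a::euclidean_space"
  assumes "0 < r"
  shows "(LINT y|lebesgue. mol a r y) = (LINT y|lebesgue. mol (0::'a) 1 y)"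
proof -
  have m[measurable]: "mol a r \<in> borel_measurable borel" "mol (0::'a) 1 \<in> borel_measurable borel"
    using mol_continuous_on_UNIV[OF assms] mol_continuous_on_UNIV[of 1 "0::'a"]
    by (auto intro: borel_measurable_continuous_onI)
  have eq: "r ^ DIM('a) * mol a r (a + r *\<^sub>R y) = mol 0 1 y" for y
    using assms by (simp add: mol_def power2_eq_square)
  have "(LINT y|lborel. mol a r y) =
      (LINT y|density (distr lborel borel (\<lambda>x. a + r *\<^sub>R x)) (\<lambda>_. ennreal (r ^ DIM('a))). mol a r y)"
    using lborel_affine[of r a] assms by simp
  also have "\<dots> = (LINT y|distr lborel borel (\<lambda>x. a + r *\<^sub>R x). r ^ DIM('a) * mol a r y)"
    using assms by (subst integral_density) auto
  also have "\<dots> = (LINT y|lborel. mol (0::'a) 1 y)"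
    by (subst integral_distr) (auto simp: eq)
  finally show ?thesis by (simp add: integral_completion)
qed

lemma integral_mol_pos: "0 < (LINT y|lebesgue. mol (0::'a::euclidean_space) 1 y)"
proof -
  let ?B = "ball (0::'a) (1/2)"
  \<comment> \<open>On the ball of radius one half, \<open>1 - y \<bullet> y\<close> is at least
    3/4.\<close>
  have B: "mol 0 1 y \<ge> exp (- 4/3)" if "y \<in> ?B" for y
  proof -
    have "norm y ^ 2 \<le> (1/2)^2"
      using that by (intro power_mono) auto
    then have "y \<bullet> y \<le> 1/4" by (simp add: dot_square_norm power_divide)
    then have "1 / (1 - y \<bullet> y) \<le> 4/3" by (simp add: field_simps)
    then show ?thesis using \<open>y \<bullet> y \<le> 1/4\<close> by (simp add: mol_def pexp_def)
  qed
  have "?B \<in> lmeasurable" by simp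
  then have "integrable lebesgue (indicator ?B :: 'a \<Rightarrow> real)"
    by (intro integrable_real_indicator) (auto simp: fmeasurable_def)
  note int = integrable_mult_left[OF this, of "exp (- 4/3)"]
  have "0 < measure lebesgue ?B * exp (- 4/3)"
    using content_ball_pos[of "1/2" "0::'a"] by simp
  also have "\<dots> = (LINT y|lebesgue. indicator ?B y * exp (- 4/3))"
    by simp
  also have "\<dots> \<le> (LINT y|lebesgue. mol (0::'a) 1 y)"
    using B by (intro integral_mono[OF int] integrable_mol)
      (auto simp: indicator_def mol_bounds)
  finally show ?thesis .
qed

lemma avg_integrable:
  assumes "continuous_on \<Omega> u" "0 < r" "cball a r \<subseteq> \<Omega>"
  shows "integrable lebesgue (\<lambda>y. indicator \<Omega> y * (u y * mol a r y))"
proof -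
  obtain u' c d where "continuous_on UNIV u'" "\<And>x. x \<in> cball a r \<Longrightarrow> u' x = u x" "cball a r \<subseteq> cbox c d"
    using compact_continuous_extension[OF compact_cball continuous_on_subset[OF assms(1,3)]] by blast
  then have "set_integrable lebesgue \<Omega> (\<lambda>x. u x * mol a r x)"
    using assms mol_continuous_on_UNIV[OF assms(2), of a] mol_eq_0_outside[OF assms(2) order_refl, of _ a]
    by (intro set_integral_continuous_compact_support(1)[where K = "cball a r" and u' = u' and c = c and d = d])
      auto
  then show ?thesis by (simp add: set_integrable_def)
qed

lemma avg_le:
  fixes a :: "'a::euclidean_space"
  assumes "continuous_on \<Omega> u" "0 < r" "cball a r \<subseteq> \<Omega>" "\<And>y. y \<in> cball a r \<Longrightarrow> u y \<le> e"
  shows "avg \<Omega> u a r \<le> e * (LINT y|lebesgue. mol (0::'a) 1 y)"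
proof -
  have "avg \<Omega> u a r \<le> (LINT y|lebesgue. e * mol a r y)"
    unfolding avg_def set_lebesgue_integral_def real_scaleR_def
  proof (intro integral_mono avg_integrable integrable_mult_right integrable_mol assms)
    fix y show "indicator \<Omega> y * (u y * mol a r y) \<le> e * mol a r y"
      using assms mol_eq_0[OF assms(2), of y a] mol_bounds(1)[OF assms(2), of a y]
      by (cases "y \<in> cball a r") (auto simp: indicator_def intro!: mult_right_mono)
  qed
  then show ?thesis using integral_mol[OF assms(2), of a] by simp
qed

lemma avg_ge:
  fixes a :: "'a::euclidean_space"
  assumes "continuous_on \<Omega> u" "0 < r" "cball a r \<subseteq> \<Omega>" "\<And>y. y \<in> cball a r \<Longrightarrow> e \<le> u y"
  shows "e * (LINT y|lebesgue. mol (0::'a) 1 y) \<le> avg \<Omega> u a r"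
proof -
  have "(LINT y|lebesgue. e * mol a r y) \<le> avg \<Omega> u a r"
    unfolding avg_def set_lebesgue_integral_def real_scaleR_def
  proof (intro integral_mono avg_integrable integrable_mult_right integrable_mol assms)
    fix y show "e * mol a r y \<le> indicator \<Omega> y * (u y * mol a r y)"
      using assms mol_eq_0[OF assms(2), of y a] mol_bounds(1)[OF assms(2), of a y]
      by (cases "y \<in> cball a r") (auto simp: indicator_def intro!: mult_right_mono)
  qed
  then show ?thesis using integral_mol[OF assms(2), of a] by simp
qed

section \<open>Transport of averages from one ball to another\<close>

lemma cball_convex_combination:
  fixes K :: "'a::real_normed_vector set"
  assumes "convex K" "cball a r \<subseteq> K" "cball b r' \<subseteq> K" "0 < r" "0 < r'" "t \<in> {0..1}"
  shows "cball (a + t *\<^sub>R (b - a)) (r + t * (r' - r)) \<subseteq> K"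
proof
  fix y assume y: "y \<in> cball (a + t *\<^sub>R (b - a)) (r + t * (r' - r))"
  define R where "R = r + t * (r' - r)"
  have "R = (1 - t) * r + t * r'" by (simp add: R_def algebra_simps)
  then have R: "0 < R"
    using assms by (cases "t = 0") (auto intro: add_nonneg_pos)
  \<comment> \<open>\<open>w\<close> is the position of \<open>y\<close> normalised to the unit
    ball. Then \<open>y\<close> is the convex combination, with weight \<open>t\<close>, of the
    points at the same position in the two given balls.\<close>
  define w where "w = (1 / R) *\<^sub>R (y - (a + t *\<^sub>R (b - a)))"
  have "norm w \<le> 1"
    using y R by (simp add: w_def R_def[symmetric] dist_norm norm_minus_commute)
  then have "a + r *\<^sub>R w \<in> cball a r" "b + r' *\<^sub>R w \<in> cball b r'"
    using assms by (auto simp: dist_norm)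
  then have "a + r *\<^sub>R w \<in> K" "b + r' *\<^sub>R w \<in> K"
    using assms by blast+
  then have "(1 - t) *\<^sub>R (a + r *\<^sub>R w) + t *\<^sub>R (b + r' *\<^sub>R w) \<in> K"
    using assms by (intro convexD) auto
  moreover have "(1 - t) *\<^sub>R (a + r *\<^sub>R w) + t *\<^sub>R (b + r' *\<^sub>R w) = a + t *\<^sub>R (b - a) + R *\<^sub>R w"
    by (simp add: R_def algebra_simps)
  moreover have "R *\<^sub>R w = y - (a + t *\<^sub>R (b - a))"
    using R by (simp add: w_def)
  ultimately show "y \<in> K" by simp
qed

lemma Lp_loc_1_integrable:
  assumes "Lp_loc 1 \<Omega> g" "compact K" "K \<subseteq> \<Omega>"
  shows "integrable lebesgue (\<lambda>x. indicator K x *\<^sub>R g x)"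
proof -
  have "set_borel_measurable lebesgue K g" "set_integrable lebesgue K (\<lambda>x. norm (g x) powr 1)"
    using assms unfolding Lp_loc_def by auto
  then have f: "(\<lambda>x. indicator K x *\<^sub>R g x) \<in> borel_measurable lebesgue"
    "integrable lebesgue (\<lambda>x. indicator K x *\<^sub>R (norm (g x) powr 1))"
    unfolding set_integrable_def set_borel_measurable_def by blast+
  have "norm (indicator K x *\<^sub>R g x) \<le> norm (indicator K x *\<^sub>R (norm (g x) powr 1))" for x
    by (simp add: indicator_def)
  then show ?thesis
    by (intro Bochner_Integration.integrable_bound[OF f(2,1)] AE_I2)
qed

text \<open>Testing with each component and summing gives minus the integral of
  \<open>(g x \<bullet> V x) * mol a R x\<close> for the field
  \<open>V x = v + (\<rho> / R) *\<^sub>R (x - a)\<close>. On the ball the field has norm at most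
  \<open>norm v + \<bar>\<rho>\<bar>\<close>, and the kernel is at most
  \<open>1 / R ^ DIM('a)\<close>.\<close>

lemma weak_gradient_field_mol_le:
  fixes a v :: "'a::euclidean_space"
  assumes wg: "weak_gradient \<Omega> u g" and K: "compact K" "K \<subseteq> \<Omega>" and R: "0 < R" "cball a R \<subseteq> K"
  shows "\<bar>\<Sum>b\<in>Basis. LINT x:\<Omega>|lebesgue.
      u x * frechet_derivative (\<lambda>y. ((v + (\<rho> / R) *\<^sub>R (y - a)) \<bullet> b) * mol a R y) (at x) b\<bar>
    \<le> (norm v + \<bar>\<rho>\<bar>) / R ^ DIM('a) * (LINT x:K|lebesgue. norm (g x))"
proof -
  define \<phi> where "\<phi> b = (\<lambda>y. ((v + (\<rho> / R) *\<^sub>R (y - a)) \<bullet> b) * mol a R y)" for b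
  define G where "G x = indicator K x *\<^sub>R g x" for x
  have G: "integrable lebesgue G"
    unfolding G_def using wg K by (intro Lp_loc_1_integrable) (auto simp: weak_gradient_def)
  have zero: "\<phi> b x = 0" if "x \<notin> K" for b x
    using mol_eq_0_outside[OF R that] by (simp add: \<phi>_def)
  have test: "test_function \<Omega> (\<phi> b)" for b
    unfolding \<phi>_def using R K by (intro test_function_field_mol) auto
  have step: "(LINT x:\<Omega>|lebesgue. u x * frechet_derivative (\<phi> b) (at x) b) = - (LINT x|lebesgue. (G x \<bullet> b) * \<phi> b x)"
    if "b \<in> Basis" for b
  proof -
    have "(LINT x:\<Omega>|lebesgue. u x * frechet_derivative (\<phi> b) (at x) b) = - (LINT x:\<Omega>|lebesgue. (g x \<bullet> b) * \<phi> b x)"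
      using wg test that unfolding weak_gradient_def by blast
    also have "(LINT x:\<Omega>|lebesgue. (g x \<bullet> b) * \<phi> b x) = (LINT x|lebesgue. (G x \<bullet> b) * \<phi> b x)"
      unfolding set_lebesgue_integral_def G_def using zero K(2)
      by (intro Bochner_Integration.integral_cong) (auto simp: indicator_def)
    finally show ?thesis .
  qed
  have bd: "norm (v + (\<rho> / R) *\<^sub>R (x - a)) * mol a R x \<le> (norm v + \<bar>\<rho>\<bar>) / R ^ DIM('a)" for x
  proof (cases "x \<in> ball a R")
    case True
    then have "norm (x - a) \<le> R" by (simp add: dist_norm norm_minus_commute)
    have "norm (v + (\<rho> / R) *\<^sub>R (x - a)) \<le> norm v + \<bar>\<rho>\<bar> / R * norm (x - a)"
      using R norm_triangle_ineq[of v "(\<rho> / R) *\<^sub>R (x - a)"] by simp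
    also have "\<bar>\<rho>\<bar> / R * norm (x - a) \<le> \<bar>\<rho>\<bar> / R * R"
      using R \<open>norm (x - a) \<le> R\<close> by (intro mult_left_mono) auto
    finally have "norm (v + (\<rho> / R) *\<^sub>R (x - a)) \<le> norm v + \<bar>\<rho>\<bar>" using R by simp
    then have "norm (v + (\<rho> / R) *\<^sub>R (x - a)) * mol a R x \<le> (norm v + \<bar>\<rho>\<bar>) * (1 / R ^ DIM('a))"
      using mol_bounds[OF R(1)] by (intro mult_mono) auto
    then show ?thesis by simp
  next
    case False
    then show ?thesis using mol_eq_0[OF R(1) False] R by simp
  qed
  have \<phi>m: "\<phi> b \<in> borel_measurable lebesgue" for b
  proof -
    have "continuous_on UNIV (\<phi> b)"
      unfolding \<phi>_def by (intro continuous_intros mol_continuous_on_UNIV) (use R in auto)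
    then show ?thesis
      by (intro measurable_completion) (simp add: borel_measurable_continuous_onI)
  qed
  have \<phi>b: "\<bar>\<phi> b x\<bar> \<le> (norm v + \<bar>\<rho>\<bar>) / R ^ DIM('a)" if "b \<in> Basis" for b x
  proof -
    have "\<bar>(v + (\<rho> / R) *\<^sub>R (x - a)) \<bullet> b\<bar> \<le> norm (v + (\<rho> / R) *\<^sub>R (x - a))"
      using that by (rule Basis_le_norm)
    then have "\<bar>\<phi> b x\<bar> \<le> norm (v + (\<rho> / R) *\<^sub>R (x - a)) * mol a R x"
      using mol_bounds(1)[OF R(1), of a x] by (auto simp: \<phi>_def abs_mult intro!: mult_right_mono)
    then show ?thesis using bd by (rule order_trans)
  qed
  have int: "integrable lebesgue (\<lambda>x. (G x \<bullet> b) * \<phi> b x)" if b: "b \<in> Basis" for b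
  proof (rule Bochner_Integration.integrable_bound)
    show "integrable lebesgue (\<lambda>x. ((norm v + \<bar>\<rho>\<bar>) / R ^ DIM('a)) * norm (G x))"
      using G by (intro integrable_mult_right integrable_norm)
    show "(\<lambda>x. (G x \<bullet> b) * \<phi> b x) \<in> borel_measurable lebesgue"
      using G \<phi>m by (intro borel_measurable_times borel_measurable_inner) (auto dest: borel_measurable_integrable)
    show "AE x in lebesgue. norm ((G x \<bullet> b) * \<phi> b x) \<le> norm (((norm v + \<bar>\<rho>\<bar>) / R ^ DIM('a)) * norm (G x))"
    proof (rule AE_I2)
      fix x
      have "\<bar>G x \<bullet> b\<bar> * \<bar>\<phi> b x\<bar> \<le> norm (G x) * ((norm v + \<bar>\<rho>\<bar>) / R ^ DIM('a))"
        using b \<phi>b[OF b] by (intro mult_mono Basis_le_norm) auto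
      then show "norm ((G x \<bullet> b) * \<phi> b x) \<le> norm (((norm v + \<bar>\<rho>\<bar>) / R ^ DIM('a)) * norm (G x))"
        using R by (simp add: abs_mult mult.commute)
    qed
  qed
  have "(\<Sum>b\<in>Basis. LINT x:\<Omega>|lebesgue. u x * frechet_derivative (\<phi> b) (at x) b)
      = - (\<Sum>b\<in>Basis. LINT x|lebesgue. (G x \<bullet> b) * \<phi> b x)"
    using step by (simp add: sum_negf)
  also have "(\<Sum>b\<in>Basis. LINT x|lebesgue. (G x \<bullet> b) * \<phi> b x) = (LINT x|lebesgue. (\<Sum>b\<in>Basis. (G x \<bullet> b) * \<phi> b x))"
    using int by (intro Bochner_Integration.integral_sum[symmetric])
  also have "(\<lambda>x. \<Sum>b\<in>Basis. (G x \<bullet> b) * \<phi> b x) = (\<lambda>x. (G x \<bullet> (v + (\<rho> / R) *\<^sub>R (x - a))) * mol a R x)"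
    unfolding \<phi>_def
    by (subst euclidean_inner[of "G _"]) (simp add: sum_distrib_right mult.assoc)
  finally have "\<bar>\<Sum>b\<in>Basis. LINT x:\<Omega>|lebesgue. u x * frechet_derivative (\<phi> b) (at x) b\<bar>
      = \<bar>LINT x|lebesgue. (G x \<bullet> (v + (\<rho> / R) *\<^sub>R (x - a))) * mol a R x\<bar>" by simp
  also have "\<dots> \<le> (LINT x|lebesgue. \<bar>(G x \<bullet> (v + (\<rho> / R) *\<^sub>R (x - a))) * mol a R x\<bar>)"
    by (rule integral_abs_bound)
  also have "\<dots> \<le> (LINT x|lebesgue. (norm v + \<bar>\<rho>\<bar>) / R ^ DIM('a) * norm (G x))"
  proof (rule integral_mono')
    show "integrable lebesgue (\<lambda>x. ((norm v + \<bar>\<rho>\<bar>) / R ^ DIM('a)) * norm (G x))"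
      using G by (intro integrable_mult_right integrable_norm)
    fix x
    have "\<bar>G x \<bullet> (v + (\<rho> / R) *\<^sub>R (x - a))\<bar> * mol a R x
        \<le> norm (G x) * norm (v + (\<rho> / R) *\<^sub>R (x - a)) * mol a R x"
      using mol_bounds(1)[OF R(1), of a x] by (intro mult_right_mono Cauchy_Schwarz_ineq2)
    also have "\<dots> \<le> norm (G x) * ((norm v + \<bar>\<rho>\<bar>) / R ^ DIM('a))"
      unfolding mult.assoc by (intro mult_left_mono bd) auto
    finally show "\<bar>(G x \<bullet> (v + (\<rho> / R) *\<^sub>R (x - a))) * mol a R x\<bar> \<le> (norm v + \<bar>\<rho>\<bar>) / R ^ DIM('a) * norm (G x)"
      using mol_bounds(1)[OF R(1), of a x] by (simp add: abs_mult mult.commute)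
  qed (use R in auto)
  also have "\<dots> = (norm v + \<bar>\<rho>\<bar>) / R ^ DIM('a) * (LINT x:K|lebesgue. norm (g x))"
    by (simp add: set_lebesgue_integral_def G_def)
  finally show ?thesis unfolding \<phi>_def .
qed

text \<open>Moving the ball with velocity \<open>v\<close> and changing its radius at rate \<open>\<rho>\<close> transports the kernel
  along the field \<open>V y = v + (\<rho> / R) *\<^sub>R (y - A)\<close>: the time derivative of \<open>mol\<close> is \<open>- div (V * mol)\<close>, so
  the derivative of the average is the integral of \<open>(g \<bullet> V) * mol\<close>.\<close>

lemma avg_diff_le:
  fixes a b :: "'a::euclidean_space"
  assumes wg: "weak_gradient \<Omega> u g" and u: "continuous_on \<Omega> u"
    and K: "compact K" "convex K" "K \<subseteq> \<Omega>" "cball a r \<subseteq> K" "cball b r' \<subseteq> K"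
    and r: "0 < r0" "r0 \<le> r" "r0 \<le> r'"
  shows "\<bar>avg \<Omega> u a r - avg \<Omega> u b r'\<bar>
    \<le> (dist a b + \<bar>r - r'\<bar>) / r0 ^ DIM('a) * (LINT x:K|lebesgue. norm (g x))"
proof -
  obtain u' c d where u': "continuous_on UNIV u'" "\<And>x. x \<in> K \<Longrightarrow> u' x = u x" "K \<subseteq> cbox c d"
    using compact_continuous_extension[OF K(1) continuous_on_subset[OF u K(3)]] by blast
  define v \<rho> where "v = b - a" and "\<rho> = r' - r"
  define A R where "A t = a + t *\<^sub>R v" and "R t = r + t * \<rho>" for t
  have Rge: "r0 \<le> R t" if "t \<in> {0..1}" for t
  proof -
    have "(1 - t) * r0 + t * r0 \<le> (1 - t) * r + t * r'"
      using that r by (intro add_mono mult_left_mono) auto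
    then show ?thesis by (simp add: R_def \<rho>_def algebra_simps)
  qed
  then have Rpos: "0 < R t" if "t \<in> {0..1}" for t
    using that r(1) by fastforce
  have cb: "cball (A t) (R t) \<subseteq> K" if "t \<in> {0..1}" for t
    unfolding A_def R_def v_def \<rho>_def using that r K by (intro cball_convex_combination) auto
  define h where "h t y = mol (A t) (R t) y" for t y
  define h' where "h' t y = - real DIM('a) * \<rho> / R t * mol (A t) (R t) y +
      2 * ((y - A t) \<bullet> (v + (\<rho> / R t) *\<^sub>R (y - A t))) *
        pexp 2 (1 - (y - A t) \<bullet> (y - A t) / (R t)\<^sup>2) / R t ^ (DIM('a) + 2)" for t y
  have hd: "((\<lambda>t. h t y) has_real_derivative h' t y) (at t)" if "t \<in> {0..1}" for t y
    using mol_has_real_derivative[of r t \<rho> a v y] Rpos[OF that]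
    unfolding h_def h'_def A_def R_def by simp
  \<comment> \<open>The average over the moving ball, written as an integral over a fixed box so
    that the Leibniz rule applies; \<open>Uavg\<close> below identifies the two.\<close>
  define U where "U t = integral (cbox c d) (\<lambda>y. u' y * h t y)" for t
  have contA: "continuous_on S (\<lambda>x. A (f x))" "continuous_on S (\<lambda>x. R (f x))"
    if "continuous_on S f" for S and f :: "real \<times> 'a \<Rightarrow> real"
    unfolding A_def R_def using that by (auto intro!: continuous_intros)
  have Ud: "(U has_field_derivative integral (cbox c d) (\<lambda>y. u' y * h' t y)) (at t within {0..1})"
    if t: "t \<in> {0..1}" for t
    unfolding U_def
  proof (rule leibniz_rule_field_derivative)
    show "((\<lambda>x. u' y * h x y) has_field_derivative u' y * h' x y) (at x within {0..1})"
      if "x \<in> {0..1}" for x y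
      using DERIV_subset[OF DERIV_cmult[OF hd[OF that]]] by simp
    show "(\<lambda>y. u' y * h x y) integrable_on cbox c d" if "x \<in> {0..1}" for x
      unfolding h_def using Rpos[OF that] u'(1)
      by (intro integrable_continuous continuous_intros continuous_on_subset[OF mol_continuous_on_UNIV]
          continuous_on_subset[OF u'(1)]) auto
    have R0: "R (fst z) \<noteq> 0" if "z \<in> {0..1} \<times> cbox c d" for z
      using Rpos[of "fst z"] that by (simp add: mem_Times_iff)
    have "continuous_on ({0..1} \<times> cbox c d) (\<lambda>z. u' (snd z) * h' (fst z) (snd z))"
      unfolding h'_def
      by (intro continuous_intros contA continuous_on_compose2[OF u'(1)] ballI)
        (auto simp: R0)
    then show "continuous_on ({0..1} \<times> cbox c d) (\<lambda>(x, y). u' y * h' x y)"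
      by (simp add: case_prod_unfold)
  qed (use t in auto)
  have Uavg: "U t = avg \<Omega> u (A t) (R t)" if "t \<in> {0..1}" for t
    unfolding U_def avg_def h_def
    using u' K mol_eq_0_outside[OF Rpos[OF that] cb[OF that]] mol_continuous_on_UNIV[OF Rpos[OF that], of "A t"]
    by (intro set_integral_continuous_compact_support(2)[where K = K, symmetric]) auto
  have U'bd: "\<bar>integral (cbox c d) (\<lambda>y. u' y * h' t y)\<bar>
      \<le> (norm v + \<bar>\<rho>\<bar>) / r0 ^ DIM('a) * (LINT x:K|lebesgue. norm (g x))" if t: "t \<in> {0..1}" for t
  proof -
    define \<phi> where "\<phi> b = (\<lambda>y. ((v + (\<rho> / R t) *\<^sub>R (y - A t)) \<bullet> b) * mol (A t) (R t) y)" for b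
    define D where "D b y = (\<rho> / R t) * mol (A t) (R t) y - ((v + (\<rho> / R t) *\<^sub>R (y - A t)) \<bullet> b) *
       (2 * (b \<bullet> (y - A t)) * pexp 2 (1 - (y - A t) \<bullet> (y - A t) / (R t)\<^sup>2) / R t ^ (DIM('a) + 2))" for b y
    have D: "frechet_derivative (\<phi> b) (at y) b = D b y" if "b \<in> Basis" for b y
      using fun_cong[OF frechet_derivative_at[OF field_mol_has_derivative[OF Rpos[OF t],
            of v "\<rho> / R t" "A t" b y]], of b] that
      unfolding \<phi>_def D_def by simp
    have Dz: "D b y = 0" if "y \<notin> K" for b y
    proof -
      have "R t \<le> norm (y - A t)" using that cb[OF t] by (force simp: dist_norm norm_minus_commute)
      then have "(R t)\<^sup>2 \<le> (y - A t) \<bullet> (y - A t)"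
        using Rpos[OF t] by (simp add: power2_norm_eq_inner[symmetric] power_mono)
      then have "pexp 2 (1 - (y - A t) \<bullet> (y - A t) / (R t)\<^sup>2) = 0"
        using Rpos[OF t] by (simp add: pexp_def field_simps)
      moreover have "mol (A t) (R t) y = 0"
        using mol_eq_0_outside[OF Rpos[OF t] cb[OF t] that] .
      ultimately show ?thesis by (simp add: D_def)
    qed
    have Dc: "continuous_on S (D b)" for b S
      unfolding D_def using Rpos[OF t] by (intro continuous_intros) auto
    \<comment> \<open>The identity behind the transport: the time derivative of the kernel is minus
      the divergence of the field times the kernel. \<open>D b\<close> is the derivative in
      direction \<open>b\<close> of the \<open>b\<close>-component.\<close>
    have sum: "h' t y = - (\<Sum>b\<in>Basis. D b y)" for y
    proof -
      define w P where "w = y - A t"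
        and "P = 2 * pexp 2 (1 - (y - A t) \<bullet> (y - A t) / (R t)\<^sup>2) / R t ^ (DIM('a) + 2)"
      define V where "V = v + (\<rho> / R t) *\<^sub>R w"
      have "w \<bullet> V = (\<Sum>b\<in>Basis. (V \<bullet> b) * (b \<bullet> w))"
        by (subst inner_commute, subst euclidean_inner) (simp add: inner_commute)
      moreover have "D b y = (\<rho> / R t) * mol (A t) (R t) y - ((V \<bullet> b) * (b \<bullet> w)) * P" for b
        unfolding D_def P_def V_def w_def by (simp add: mult_ac)
      then have "(\<Sum>b\<in>Basis. D b y) = real DIM('a) * ((\<rho> / R t) * mol (A t) (R t) y) -
         (\<Sum>b\<in>Basis. (V \<bullet> b) * (b \<bullet> w)) * P"
        by (simp add: sum_subtractf sum_distrib_right)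
      moreover have "h' t y = - (real DIM('a) * ((\<rho> / R t) * mol (A t) (R t) y)) + (w \<bullet> V) * P"
        unfolding h'_def P_def V_def w_def by (simp add: mult_ac)
      ultimately show ?thesis by simp
    qed
    have int: "(\<lambda>y. u' y * D b y) integrable_on cbox c d" for b
      by (intro integrable_continuous continuous_intros Dc continuous_on_subset[OF u'(1)]) auto
    have "integral (cbox c d) (\<lambda>y. u' y * h' t y) = integral (cbox c d) (\<lambda>y. - (\<Sum>b\<in>Basis. u' y * D b y))"
      by (simp add: sum sum_distrib_left)
    also have "\<dots> = - (\<Sum>b\<in>Basis. integral (cbox c d) (\<lambda>y. u' y * D b y))"
      using int by (simp add: integral_sum)
    also have "(\<Sum>b\<in>Basis. integral (cbox c d) (\<lambda>y. u' y * D b y))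
        = (\<Sum>b\<in>Basis. LINT x:\<Omega>|lebesgue. u x * D b x)"
      using u' K Dz Dc
      by (intro sum.cong refl set_integral_continuous_compact_support(2)[where K = K, symmetric]) auto
    also have "\<dots> = (\<Sum>b\<in>Basis. LINT x:\<Omega>|lebesgue. u x * frechet_derivative (\<phi> b) (at x) b)"
      using D by simp
    finally have "\<bar>integral (cbox c d) (\<lambda>y. u' y * h' t y)\<bar> =
        \<bar>\<Sum>b\<in>Basis. LINT x:\<Omega>|lebesgue. u x * frechet_derivative (\<phi> b) (at x) b\<bar>" by simp
    also have "\<dots> \<le> (norm v + \<bar>\<rho>\<bar>) / R t ^ DIM('a) * (LINT x:K|lebesgue. norm (g x))"
      unfolding \<phi>_def using cb[OF t] Rpos[OF t] K by (intro weak_gradient_field_mol_le[OF wg]) auto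
    also have "\<dots> \<le> (norm v + \<bar>\<rho>\<bar>) / r0 ^ DIM('a) * (LINT x:K|lebesgue. norm (g x))"
    proof (rule mult_right_mono)
      show "(norm v + \<bar>\<rho>\<bar>) / R t ^ DIM('a) \<le> (norm v + \<bar>\<rho>\<bar>) / r0 ^ DIM('a)"
        using Rge[OF t] Rpos[OF t] r by (intro divide_left_mono power_mono) auto
      show "0 \<le> (LINT x:K|lebesgue. norm (g x))"
        unfolding set_lebesgue_integral_def by (intro Bochner_Integration.integral_nonneg) auto
    qed
    finally show ?thesis .
  qed
  \<comment> \<open>Mean value inequality on the unit time interval.\<close>
  have "norm (U 0 - U 1) \<le> ((norm v + \<bar>\<rho>\<bar>) / r0 ^ DIM('a) * (LINT x:K|lebesgue. norm (g x))) * norm (0 - 1 :: real)"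
    using Ud U'bd by (intro field_differentiable_bound[where S = "{0..1}"]) auto
  moreover have "U 0 = avg \<Omega> u a r" "U 1 = avg \<Omega> u b r'"
    using Uavg[of 0] Uavg[of 1] by (auto simp: A_def R_def v_def \<rho>_def)
  ultimately show ?thesis
    by (simp add: v_def \<rho>_def dist_norm norm_minus_commute abs_minus_commute)
qed

section \<open>Averages along connected sets\<close>

text \<open>For \<open>t > \<kappa>\<close> the factor \<open>(t / \<kappa>) powr (p - 1)\<close> is
  at least 1. Keeping \<kappa> free allows a different choice at every scale later.\<close>

lemma le_add_powr:
  fixes t \<kappa> p :: real
  assumes "0 \<le> t" "0 < \<kappa>" "1 \<le> p"
  shows "t \<le> \<kappa> + \<kappa> powr (1 - p) * t powr p"
proof (cases "t \<le> \<kappa>")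
  case True
  then show ?thesis by (simp add: add_increasing2)
next
  case False
  then have "\<kappa> powr (p - 1) \<le> t powr (p - 1)"
    using assms by (intro powr_mono2) auto
  then have "\<kappa> powr (1 - p) * \<kappa> powr (p - 1) * t \<le> \<kappa> powr (1 - p) * t powr (p - 1) * t"
    using assms by (intro mult_right_mono mult_left_mono) auto
  moreover have "\<kappa> powr (1 - p) * \<kappa> powr (p - 1) = 1"
    using assms by (simp flip: powr_add)
  moreover have "t powr (p - 1) * t = t powr p"
    using False assms powr_add[of t "p - 1" 1] by simp
  ultimately show ?thesis using assms by (simp add: mult.assoc)
qed

lemma set_integral_norm_le:
  assumes "Lp_loc 1 \<Omega> g" and w: "set_integrable lebesgue \<Omega> (\<lambda>x. norm (g x) powr p)"
    and K: "compact K" "K \<subseteq> \<Omega>" and "0 < \<kappa>" "1 \<le> p"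
  shows "(LINT x:K|lebesgue. norm (g x))
    \<le> \<kappa> * measure lebesgue K + \<kappa> powr (1 - p) * (LINT x:K|lebesgue. norm (g x) powr p)"
proof -
  have Km: "K \<in> lmeasurable" using K by (intro lmeasurable_compact)
  have i0: "integrable lebesgue (\<lambda>x. indicator K x *\<^sub>R norm (g x))"
    using integrable_norm[OF Lp_loc_1_integrable[OF assms(1) K]] by simp
  have i1: "integrable lebesgue (\<lambda>x. \<kappa> * indicator K x)"
    using Km by (intro integrable_mult_right integrable_real_indicator) (auto simp: fmeasurable_def)
  have "set_integrable lebesgue K (\<lambda>x. norm (g x) powr p)"
    using Km by (intro set_integrable_subset[OF w _ K(2)]) auto
  then have i2: "integrable lebesgue (\<lambda>x. \<kappa> powr (1 - p) * (indicator K x *\<^sub>R norm (g x) powr p))"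
    unfolding set_integrable_def by (rule integrable_mult_right)
  have "(LINT x:K|lebesgue. norm (g x))
      \<le> (LINT x|lebesgue. \<kappa> * indicator K x + \<kappa> powr (1 - p) * (indicator K x *\<^sub>R norm (g x) powr p))"
    unfolding set_lebesgue_integral_def
  proof (rule integral_mono)
    fix x show "indicator K x *\<^sub>R norm (g x) \<le> \<kappa> * indicator K x + \<kappa> powr (1 - p) * (indicator K x *\<^sub>R norm (g x) powr p)"
      using le_add_powr[of "norm (g x)" \<kappa> p] assms by (simp add: indicator_def)
  qed (intro i0 i1 i2 Bochner_Integration.integrable_add)+
  also have "\<dots> = \<kappa> * measure lebesgue K + \<kappa> powr (1 - p) * (LINT x:K|lebesgue. norm (g x) powr p)"
    unfolding set_lebesgue_integral_def using i1 i2 Km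
    by (simp add: Bochner_Integration.integral_add)
  finally show ?thesis .
qed

text \<open>Volume packing: the balls of radius \<open>\<rho> / 2\<close> about the points of
  \<open>Z\<close> are disjoint and lie in one ball of radius \<open>S + \<rho> / 2\<close>.\<close>

lemma separated_card_le:
  fixes Z :: "'a::euclidean_space set"
  assumes "finite Z" and sep: "pairwise (\<lambda>x y. \<rho> \<le> dist x y) Z" and "Z \<subseteq> cball c S" "0 < \<rho>" "0 \<le> S"
  shows "real (card Z) * \<rho> ^ DIM('a) \<le> (2 * S + \<rho>) ^ DIM('a)"
proof -
  let ?v = "measure lebesgue (ball (0::'a) 1)"
  have v: "0 < ?v" using content_ball_pos[of 1 "0::'a"] by simp
  have disj: "disjoint_family_on (\<lambda>z. ball z (\<rho> / 2)) Z"
  proof (unfold disjoint_family_on_def, safe)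
    fix x y w assume "x \<in> Z" "y \<in> Z" "x \<noteq> y" and w: "w \<in> ball x (\<rho> / 2)" "w \<in> ball y (\<rho> / 2)"
    then have "\<rho> \<le> dist x y" using sep by (auto simp: pairwise_def)
    also have "\<dots> \<le> dist x w + dist y w" by (rule dist_triangle2)
    finally show "w \<in> {}" using w by simp
  qed
  have "real (card Z) * ((\<rho> / 2) ^ DIM('a) * ?v) = (\<Sum>z\<in>Z. measure lebesgue (ball z (\<rho> / 2)))"
    using assms by (simp add: content_ball_conv_unit_ball[where r = "\<rho> / 2"])
  also have "\<dots> = measure lebesgue (\<Union>z\<in>Z. ball z (\<rho> / 2))"
    using assms(1) disj less_imp_neq[OF emeasure_lborel_ball_finite[of _ "\<rho> / 2"]]
    by (intro measure_finite_Union[symmetric]) auto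
  also have "\<dots> \<le> measure lebesgue (ball c (S + \<rho> / 2))"
  proof (rule measure_mono_fmeasurable)
    show "(\<Union>z\<in>Z. ball z (\<rho> / 2)) \<subseteq> ball c (S + \<rho> / 2)"
    proof safe
      fix z w assume "z \<in> Z" and w: "w \<in> ball z (\<rho> / 2)"
      then have "dist c z \<le> S" using assms(3) by auto
      then show "w \<in> ball c (S + \<rho> / 2)"
        using w dist_triangle[of c w z] by simp
    qed
    show "(\<Union>z\<in>Z. ball z (\<rho> / 2)) \<in> sets lebesgue"
      using assms(1) by (intro sets.finite_UN) auto
  qed auto
  also have "\<dots> = (S + \<rho> / 2) ^ DIM('a) * ?v"
    using assms by (simp add: content_ball_conv_unit_ball[where r = "S + \<rho> / 2"])
  finally have "real (card Z) * (\<rho> / 2) ^ DIM('a) \<le> (S + \<rho> / 2) ^ DIM('a)"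
    using v by (simp flip: mult.assoc)
  then have "real (card Z) * (\<rho> / 2) ^ DIM('a) * 2 ^ DIM('a) \<le> (S + \<rho> / 2) ^ DIM('a) * 2 ^ DIM('a)"
    by (rule mult_right_mono) simp
  moreover have "(\<rho> / 2) ^ DIM('a) * 2 ^ DIM('a) = \<rho> ^ DIM('a)"
    "(S + \<rho> / 2) ^ DIM('a) * 2 ^ DIM('a) = (2 * S + \<rho>) ^ DIM('a)"
    by (simp_all add: algebra_simps flip: power_mult_distrib)
  ultimately show ?thesis by (simp only: mult.assoc)
qed

text \<open>The image of \<open>\<Gamma>\<close> is an interval covered by intervals of length \<open>2 * e z\<close>. This replaces the
  selection of a chain of overlapping balls.\<close>

lemma connected_oscillation_le:
  fixes f :: "'a::metric_space \<Rightarrow> real"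
  assumes "connected \<Gamma>" "continuous_on \<Gamma> f" "finite Z" "Z \<subseteq> \<Gamma>" "\<Gamma> \<subseteq> (\<Union>z\<in>Z. ball z \<rho>)" "0 < \<rho>"
    and e: "\<And>z y. z \<in> Z \<Longrightarrow> y \<in> \<Gamma> \<Longrightarrow> dist z y < \<rho> \<Longrightarrow> \<bar>f y - f z\<bar> \<le> e z"
    and "a \<in> \<Gamma>" "b \<in> \<Gamma>"
  shows "\<bar>f a - f b\<bar> \<le> 2 * (\<Sum>z\<in>Z. e z)"
proof -
  have main: "f y - f x \<le> 2 * (\<Sum>z\<in>Z. e z)" if "x \<in> \<Gamma>" "y \<in> \<Gamma>" "f x \<le> f y" for x y
  proof -
    have e0: "0 \<le> e z" if "z \<in> Z" for z
      using e[OF that, of z] that assms by auto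
    have "{f x..f y} \<subseteq> f ` \<Gamma>"
      using connected_contains_Icc[OF connected_continuous_image[OF assms(2,1)]] that by blast
    also have "\<dots> \<subseteq> (\<Union>z\<in>Z. {f z - e z..f z + e z})"
    proof safe
      fix y assume "y \<in> \<Gamma>"
      then obtain z where "z \<in> Z" "dist z y < \<rho>" using assms(5) by auto
      then have "\<bar>f y - f z\<bar> \<le> e z" using e \<open>y \<in> \<Gamma>\<close> by blast
      then show "f y \<in> (\<Union>z\<in>Z. {f z - e z..f z + e z})"
        using \<open>z \<in> Z\<close> by (intro UN_I[of z]) auto
    qed
    finally have sub: "{f x..f y} \<subseteq> (\<Union>z\<in>Z. {f z - e z..f z + e z})" .
    have "f y - f x = measure lebesgue {f x..f y}" using that by simp
    also have "\<dots> \<le> measure lebesgue (\<Union>z\<in>Z. {f z - e z..f z + e z})"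
      using sub assms(3) by (intro measure_mono_fmeasurable fmeasurable.finite_UN) auto
    also have "\<dots> \<le> (\<Sum>z\<in>Z. measure lebesgue {f z - e z..f z + e z})"
      using assms(3) by (intro measure_UNION_le) auto
    also have "\<dots> = (\<Sum>z\<in>Z. 2 * e z)"
      using e0 by (intro sum.cong) auto
    finally show ?thesis by (simp add: sum_distrib_left)
  qed
  show ?thesis
    using main[of a b] main[of b a] assms by linarith
qed

text \<open>A separated set of largest cardinality is a net, since a point far from it could be
  added. The bound \<open>M\<close> guarantees that a largest cardinality exists.\<close>

lemma exists_separated_net:
  fixes \<Gamma> :: "'a::metric_space set"
  assumes "0 < \<rho>" and bound: "\<And>F. F \<subseteq> \<Gamma> \<Longrightarrow> finite F \<Longrightarrow> pairwise (\<lambda>x y. \<rho> \<le> dist x y) F \<Longrightarrow> real (card F) \<le> M"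
  obtains Z where "finite Z" "Z \<subseteq> \<Gamma>" "pairwise (\<lambda>x y. \<rho> \<le> dist x y) Z" "\<Gamma> \<subseteq> (\<Union>z\<in>Z. ball z \<rho>)"
proof -
  let ?P = "\<lambda>F. F \<subseteq> \<Gamma> \<and> finite F \<and> pairwise (\<lambda>x y. \<rho> \<le> dist x y) F"
  have "?P {}" by simp
  moreover have "\<forall>F. ?P F \<longrightarrow> card F < Suc (nat \<lfloor>M\<rfloor>)"
    using bound by (auto simp: le_nat_floor less_Suc_eq_le)
  ultimately have "\<exists>Z. ?P Z \<and> (\<forall>F. ?P F \<longrightarrow> card F \<le> card Z)"
    by (rule ex_has_greatest_nat)
  then obtain Z where "?P Z \<and> (\<forall>F. ?P F \<longrightarrow> card F \<le> card Z)"
    by (rule exE)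
  note Z = conjunct1[OF this] conjunct2[OF this]
  have "\<exists>z\<in>Z. dist z x < \<rho>" if "x \<in> \<Gamma>" for x
  proof (rule ccontr)
    assume "\<not> (\<exists>z\<in>Z. dist z x < \<rho>)"
    then have far: "\<And>z. z \<in> Z \<Longrightarrow> \<rho> \<le> dist z x" by force
    then have "x \<notin> Z" using assms(1) by fastforce
    moreover have "?P (insert x Z)"
      using Z(1) that far by (auto simp: pairwise_insert dist_commute)
    then have "card (insert x Z) \<le> card Z" using Z(2) by blast
    ultimately show False using Z(1) by simp
  qed
  then have "\<Gamma> \<subseteq> (\<Union>z\<in>Z. ball z \<rho>)" by auto
  with Z(1) show ?thesis by (intro that[of Z]) simp_all
qed

text \<open>Each point of a \<rho>-net contributes one ball of radius \<open>2 * \<rho>\<close>. The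
  \<kappa>-terms add up over at most \<open>M\<close> balls, whereas the energies add up only with
  the overlap number \<open>5 ^ DIM('a)\<close>; hence \<open>M\<close> does not multiply the
  energy.\<close>

lemma avg_diff_connected_le:
  fixes \<Gamma> :: "'a::euclidean_space set"
  assumes wg: "weak_gradient \<Omega> u g" and u: "continuous_on \<Omega> u"
    and w: "set_integrable lebesgue \<Omega> (\<lambda>x. norm (g x) powr p)" and p: "1 \<le> p"
    and \<Gamma>: "connected \<Gamma>" and \<rho>: "0 < \<rho>" and "0 < \<kappa>"
    and A: "A \<in> sets lebesgue" "A \<subseteq> \<Omega>" "\<And>z. z \<in> \<Gamma> \<Longrightarrow> cball z (2 * \<rho>) \<subseteq> A"
    and M: "\<And>F. F \<subseteq> \<Gamma> \<Longrightarrow> finite F \<Longrightarrow> pairwise (\<lambda>x y. \<rho> \<le> dist x y) F \<Longrightarrow> real (card F) \<le> M"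
    and ab: "a \<in> \<Gamma>" "b \<in> \<Gamma>"
  shows "\<bar>avg \<Omega> u a \<rho> - avg \<Omega> u b \<rho>\<bar> \<le> 2 * (\<rho> / \<rho> ^ DIM('a)) *
    (\<kappa> * (M * ((2 * \<rho>) ^ DIM('a) * measure lebesgue (ball (0::'a) 1)))
      + \<kappa> powr (1 - p) * (5 ^ DIM('a) * (LINT x:A|lebesgue. norm (g x) powr p)))"
proof -
  define I where "I z = (LINT x:cball z (2 * \<rho>)|lebesgue. norm (g x))" for z
  define w where "w x = norm (g x) powr p" for x
  have g1: "Lp_loc 1 \<Omega> g" using wg by (simp add: weak_gradient_def)
  \<comment> \<open>Used twice: as a local Lipschitz bound it gives continuity of the average along
    \<Gamma>, and at the net points it bounds the local oscillation.\<close>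
  have near: "\<bar>avg \<Omega> u y \<rho> - avg \<Omega> u z \<rho>\<bar> \<le> dist z y / \<rho> ^ DIM('a) * I z"
    if "z \<in> \<Gamma>" "dist z y \<le> \<rho>" for y z
  proof -
    have sub: "cball z (2 * \<rho>) \<subseteq> \<Omega>" using A that by blast
    have "\<bar>avg \<Omega> u y \<rho> - avg \<Omega> u z \<rho>\<bar> \<le> (dist y z + \<bar>\<rho> - \<rho>\<bar>) / \<rho> ^ DIM('a) * I z"
      unfolding I_def
    proof (rule avg_diff_le[OF wg u])
      show "cball y \<rho> \<subseteq> cball z (2 * \<rho>)"
        using that by (auto simp: cball_subset_cball_iff dist_commute)
      show "cball z \<rho> \<subseteq> cball z (2 * \<rho>)" using \<rho> by (auto simp: cball_subset_cball_iff)
    qed (use \<rho> sub in simp_all)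
    then show ?thesis by (simp add: dist_commute)
  qed
  have I0: "0 \<le> I z" for z
    unfolding I_def set_lebesgue_integral_def by (intro Bochner_Integration.integral_nonneg) auto
  have cont: "continuous_on \<Gamma> (\<lambda>y. avg \<Omega> u y \<rho>)"
    unfolding continuous_on_def
  proof
    fix z assume z: "z \<in> \<Gamma>"
    have "((\<lambda>y. dist z y / \<rho> ^ DIM('a) * I z) \<longlongrightarrow> dist z z / \<rho> ^ DIM('a) * I z) (at z within \<Gamma>)"
      by (intro tendsto_intros) (use \<rho> in auto)
    moreover have "\<forall>\<^sub>F y in at z within \<Gamma>. dist (avg \<Omega> u y \<rho>) (avg \<Omega> u z \<rho>)
        \<le> dist (dist z y / \<rho> ^ DIM('a) * I z) (dist z z / \<rho> ^ DIM('a) * I z)"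
      unfolding eventually_at using \<rho> near[OF z] I0[of z]
      by (intro exI[of _ \<rho>]) (auto simp: dist_real_def dist_commute)
    ultimately show "((\<lambda>y. avg \<Omega> u y \<rho>) \<longlongrightarrow> avg \<Omega> u z \<rho>) (at z within \<Gamma>)"
      by (rule metric_tendsto_imp_tendsto)
  qed
  obtain Z where Z: "finite Z" "Z \<subseteq> \<Gamma>" "pairwise (\<lambda>x y. \<rho> \<le> dist x y) Z" "\<Gamma> \<subseteq> (\<Union>z\<in>Z. ball z \<rho>)"
    using exists_separated_net[OF \<rho> M] by blast
  have cA: "cball z (2 * \<rho>) \<subseteq> A" "cball z (2 * \<rho>) \<subseteq> \<Omega>" if "z \<in> Z" for z
    using that Z(2) A by blast+
  have "\<bar>avg \<Omega> u a \<rho> - avg \<Omega> u b \<rho>\<bar> \<le> 2 * (\<Sum>z\<in>Z. \<rho> / \<rho> ^ DIM('a) * I z)"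
  proof (rule connected_oscillation_le[OF \<Gamma> cont Z(1,2,4) \<rho>])
    fix z y assume "z \<in> Z" "y \<in> \<Gamma>" "dist z y < \<rho>"
    then have "\<bar>avg \<Omega> u y \<rho> - avg \<Omega> u z \<rho>\<bar> \<le> dist z y / \<rho> ^ DIM('a) * I z"
      using near Z(2) by auto
    also have "\<dots> \<le> \<rho> / \<rho> ^ DIM('a) * I z"
      using \<open>dist z y < \<rho>\<close> \<rho> I0 by (intro mult_right_mono divide_right_mono) auto
    finally show "\<bar>avg \<Omega> u y \<rho> - avg \<Omega> u z \<rho>\<bar> \<le> \<rho> / \<rho> ^ DIM('a) * I z" .
  qed (use ab in auto)
  also have "\<dots> = 2 * (\<rho> / \<rho> ^ DIM('a)) * (\<Sum>z\<in>Z. I z)"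
    by (simp add: sum_distrib_left mult.assoc)
  also have "\<dots> \<le> 2 * (\<rho> / \<rho> ^ DIM('a)) *
    (\<kappa> * (M * ((2 * \<rho>) ^ DIM('a) * measure lebesgue (ball (0::'a) 1)))
      + \<kappa> powr (1 - p) * (5 ^ DIM('a) * (LINT x:A|lebesgue. w x)))"
  proof (rule mult_left_mono)
    have "(\<Sum>z\<in>Z. I z) \<le> (\<Sum>z\<in>Z. \<kappa> * measure lebesgue (cball z (2 * \<rho>))
        + \<kappa> powr (1 - p) * (LINT x:cball z (2 * \<rho>)|lebesgue. w x))"
      unfolding I_def w_def using cA \<open>0 < \<kappa>\<close> p
      by (intro sum_mono set_integral_norm_le[OF g1 w]) auto
    also have "\<dots> = \<kappa> * (card Z * ((2 * \<rho>) ^ DIM('a) * measure lebesgue (ball (0::'a) 1)))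
        + \<kappa> powr (1 - p) * (\<Sum>z\<in>Z. LINT x:cball z (2 * \<rho>)|lebesgue. w x)"
      using \<rho> by (simp add: content_cball_conv_ball content_ball_conv_unit_ball[where r = "2 * \<rho>"]
          sum.distrib sum_distrib_left)
    also have "\<dots> \<le> \<kappa> * (M * ((2 * \<rho>) ^ DIM('a) * measure lebesgue (ball (0::'a) 1)))
        + \<kappa> powr (1 - p) * (5 ^ DIM('a) * (LINT x:A|lebesgue. w x))"
    proof (intro add_mono mult_left_mono mult_right_mono)
      show "real (card Z) \<le> M" using M Z by blast
      have int: "integrable lebesgue (\<lambda>x. indicator (cball z (2 * \<rho>)) x *\<^sub>R w x)" if "z \<in> Z" for z
        using set_integrable_subset[OF w _ cA(2)[OF that]] unfolding set_integrable_def w_def by simp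
      have intA: "integrable lebesgue (\<lambda>x. indicator A x *\<^sub>R w x)"
        using set_integrable_subset[OF w A(1,2)] unfolding set_integrable_def w_def by simp
      have "(\<Sum>z\<in>Z. LINT x:cball z (2 * \<rho>)|lebesgue. w x)
          = (LINT x|lebesgue. (\<Sum>z\<in>Z. indicator (cball z (2 * \<rho>)) x *\<^sub>R w x))"
        unfolding set_lebesgue_integral_def using int by (simp add: Bochner_Integration.integral_sum)
      also have "\<dots> \<le> (LINT x|lebesgue. 5 ^ DIM('a) * (indicator A x *\<^sub>R w x))"
      proof (intro integral_mono integrable_mult_right intA Bochner_Integration.integrable_sum int)
        fix x :: 'a
        \<comment> \<open>Overlap count at \<open>x\<close>: these net points are \<rho>-separated
          and lie within \<open>2 * \<rho>\<close> of \<open>x\<close>, so the packing bound applies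
          with \<open>2 * (2 * \<rho>) + \<rho> = 5 * \<rho>\<close>.\<close>
        define Zx where "Zx = {z \<in> Z. x \<in> cball z (2 * \<rho>)}"
        have "real (card Zx) * \<rho> ^ DIM('a) \<le> (2 * (2 * \<rho>) + \<rho>) ^ DIM('a)"
        proof (rule separated_card_le)
          show "finite Zx" using Z(1) by (simp add: Zx_def)
          show "pairwise (\<lambda>x y. \<rho> \<le> dist x y) Zx"
            by (rule pairwise_subset[OF Z(3)]) (auto simp: Zx_def)
          show "Zx \<subseteq> cball x (2 * \<rho>)" by (auto simp: Zx_def dist_commute)
          show "0 < \<rho>" "0 \<le> 2 * \<rho>" using \<rho> by simp_all
        qed
        also have "2 * (2 * \<rho>) + \<rho> = 5 * \<rho>" by simp
        also have "(5 * \<rho>) ^ DIM('a) = 5 ^ DIM('a) * \<rho> ^ DIM('a)" by (rule power_mult_distrib)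
        finally have card: "real (card Zx) \<le> 5 ^ DIM('a)" using \<rho> by simp
        have "(\<Sum>z\<in>Z. indicator (cball z (2 * \<rho>)) x *\<^sub>R w x) = (\<Sum>z\<in>Zx. w x)"
          unfolding Zx_def using Z(1) by (intro sum.mono_neutral_cong_right) (auto simp: indicator_def)
        also have "\<dots> = real (card Zx) * (indicator A x *\<^sub>R w x)"
        proof (cases "x \<in> A")
          case False
          then have "Zx = {}" using cA(1) unfolding Zx_def by blast
          then show ?thesis by simp
        qed simp
        also have "\<dots> \<le> 5 ^ DIM('a) * (indicator A x *\<^sub>R w x)"
          using card by (intro mult_right_mono) (auto simp: w_def)
        finally show "(\<Sum>z\<in>Z. indicator (cball z (2 * \<rho>)) x *\<^sub>R w x) \<le> 5 ^ DIM('a) * (indicator A x *\<^sub>R w x)" .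
      qed
      finally show "(\<Sum>z\<in>Z. LINT x:cball z (2 * \<rho>)|lebesgue. w x) \<le> 5 ^ DIM('a) * (LINT x:A|lebesgue. w x)"
        by (simp add: set_lebesgue_integral_def)
    qed (use \<rho> \<open>0 < \<kappa>\<close> in auto)
    finally show "(\<Sum>z\<in>Z. I z) \<le> \<kappa> * (M * ((2 * \<rho>) ^ DIM('a) * measure lebesgue (ball (0::'a) 1)))
        + \<kappa> powr (1 - p) * (5 ^ DIM('a) * (LINT x:A|lebesgue. w x))" .
  qed (use \<rho> in auto)
  finally show ?thesis unfolding w_def .
qed

section \<open>Rectifiable curves\<close>

lemma polygon_le_curve_length:
  assumes "\<And>i. i \<le> m \<Longrightarrow> \<tau> i \<in> {a..b}" "\<And>i. i < m \<Longrightarrow> \<tau> i \<le> \<tau> (Suc i)"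
  shows "(\<Sum>i<m. ennreal (dist (\<gamma> (\<tau> i)) (\<gamma> (\<tau> (Suc i))))) \<le> curve_length \<gamma> a b"
  unfolding curve_length_def using assms by (intro SUP_upper2[of "(m, \<tau>)"]) auto

lemma curve_length_mono: "b \<le> c \<Longrightarrow> curve_length \<gamma> a b \<le> curve_length \<gamma> a c"
  unfolding curve_length_def by (intro SUP_subset_mono) force+

lemma dist_le_curve_length:
  assumes "a \<le> b" shows "ennreal (dist (\<gamma> a) (\<gamma> b)) \<le> curve_length \<gamma> a b"
  using polygon_le_curve_length[of 1 "\<lambda>i. if i = 0 then a else b" a b \<gamma>] assms by simp

lemma curve_length_refl: "curve_length \<gamma> a a = 0"
proof -
  have "(\<Sum>i<m. ennreal (dist (\<gamma> (\<tau> i)) (\<gamma> (\<tau> (Suc i))))) = 0" if "\<forall>i\<le>m. \<tau> i \<in> {a..a}" for m \<tau>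
    using that by (intro sum.neutral) (auto simp: Suc_le_eq)
  then show ?thesis
    unfolding curve_length_def by (intro antisym SUP_least) auto
qed

text \<open>Visited in increasing order, the times give an inscribed polygon with
  \<open>card S - 1\<close> edges of length at least \<rho>. For empty \<open>S\<close> the
  subtraction on naturals makes the left side zero.\<close>

lemma separated_times_le_curve_length:
  assumes "finite S" "S \<subseteq> {a..b}" "0 \<le> \<rho>"
    and sep: "\<And>t t'. t \<in> S \<Longrightarrow> t' \<in> S \<Longrightarrow> t \<noteq> t' \<Longrightarrow> \<rho> \<le> dist (\<gamma> t) (\<gamma> t')"
  shows "ennreal (real (card S - 1) * \<rho>) \<le> curve_length \<gamma> a b"
proof (cases "S = {}")
  case False
  define xs where "xs = sorted_list_of_set S"
  have xs: "set xs = S" "distinct xs" "sorted xs" "length xs = card S"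
    using assms(1) by (simp_all add: xs_def)
  have len: "0 < card S" using False assms(1) by (simp add: card_gt_0_iff)
  have "ennreal (real (card S - 1) * \<rho>) = (\<Sum>i<card S - 1. ennreal \<rho>)"
    using assms(3) by (simp add: ennreal_mult ennreal_of_nat_eq_real_of_nat)
  also have "\<dots> \<le> (\<Sum>i<card S - 1. ennreal (dist (\<gamma> (xs ! i)) (\<gamma> (xs ! Suc i))))"
  proof (intro sum_mono ennreal_leI sep)
    fix i assume "i \<in> {..<card S - 1}"
    then have i: "i < length xs" "Suc i < length xs" using xs by auto
    then show "xs ! i \<in> S" "xs ! Suc i \<in> S" using xs(1) nth_mem by blast+
    show "xs ! i \<noteq> xs ! Suc i" using i xs(2) by (simp add: nth_eq_iff_index_eq)
  qed
  also have "\<dots> \<le> curve_length \<gamma> a b"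
  proof (rule polygon_le_curve_length)
    fix i assume "i \<le> card S - 1"
    then have "i < length xs" using xs len by simp
    then show "xs ! i \<in> {a..b}" using xs(1) assms(2) nth_mem by blast
  next
    fix i assume "i < card S - 1"
    then show "xs ! i \<le> xs ! Suc i" using xs by (intro sorted_nth_mono) auto
  qed
  finally show ?thesis .
qed simp

section \<open>Length travelled and exit times\<close>

definition travel :: "(real \<Rightarrow> 'a::metric_space) \<Rightarrow> real \<Rightarrow> real" where
  "travel \<gamma> t = enn2real (curve_length \<gamma> 0 t)"

lemma rectifiable_travel:
  assumes "rectifiable_path \<gamma>" "t \<le> 1"
  shows "curve_length \<gamma> 0 t = ennreal (travel \<gamma> t)"
proof -
  have "curve_length \<gamma> 0 t < \<infinity>"
    using assms curve_length_mono[of t 1 \<gamma> 0] unfolding rectifiable_path_def by auto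
  then show ?thesis by (simp add: travel_def)
qed

lemma travel_nonneg: "0 \<le> travel \<gamma> t"
  by (simp add: travel_def)

lemma travel_mono:
  assumes "rectifiable_path \<gamma>" "t \<le> t'" "t' \<le> 1" shows "travel \<gamma> t \<le> travel \<gamma> t'"
  using curve_length_mono[OF assms(2), of \<gamma> 0] rectifiable_travel[OF assms(1), of t]
    rectifiable_travel[OF assms(1), of t'] assms by (simp add: ennreal_le_iff travel_nonneg)

lemma dist_le_travel:
  assumes "rectifiable_path \<gamma>" "0 \<le> t" "t \<le> 1" shows "dist (\<gamma> 0) (\<gamma> t) \<le> travel \<gamma> t"
  using dist_le_curve_length[OF assms(2), of \<gamma>] rectifiable_travel[OF assms(1), of t] assms
  by (simp add: ennreal_le_iff travel_nonneg)

text \<open>The last time up to which the curve has length at most \<open>r\<close>. Continuity of the length in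
  time is never used: bounds at this very time come from continuity of \<open>\<gamma>\<close>.\<close>

definition exit_time :: "(real \<Rightarrow> 'a::metric_space) \<Rightarrow> real \<Rightarrow> real" where
  "exit_time \<gamma> r = Sup {t \<in> {0..1}. travel \<gamma> t \<le> r}"

lemma exit_time_set:
  assumes "0 \<le> r"
  shows "0 \<in> {t \<in> {0..1}. travel \<gamma> t \<le> r}" "bdd_above {t \<in> {0..1}. travel \<gamma> t \<le> r}"
proof -
  show "0 \<in> {t \<in> {0..1}. travel \<gamma> t \<le> r}"
    using assms by (simp add: travel_def curve_length_refl)
  show "bdd_above {t \<in> {0..1}. travel \<gamma> t \<le> r}"
    by (intro bdd_aboveI[of _ 1]) auto
qed

lemma exit_time_bounds:
  assumes "0 \<le> r" shows "0 \<le> exit_time \<gamma> r" "exit_time \<gamma> r \<le> 1"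
  unfolding exit_time_def using exit_time_set[OF assms, of \<gamma>]
  by (auto intro: cSup_upper intro!: cSup_least)

lemma exit_time_mono:
  assumes "0 \<le> r" "r \<le> r'" shows "exit_time \<gamma> r \<le> exit_time \<gamma> r'"
  unfolding exit_time_def
proof (rule cSup_subset_mono)
  show "{t \<in> {0..1}. travel \<gamma> t \<le> r} \<noteq> {}" using exit_time_set(1)[OF assms(1)] by blast
  show "bdd_above {t \<in> {0..1}. travel \<gamma> t \<le> r'}" using assms by (intro exit_time_set) simp
qed (use assms in auto)

lemma exit_time_eq_1: "0 \<le> r \<Longrightarrow> travel \<gamma> 1 \<le> r \<Longrightarrow> exit_time \<gamma> r = 1"
  using exit_time_bounds[of r \<gamma>] cSup_upper[OF _ exit_time_set(2)[of r \<gamma>], of 1]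
  by (simp add: exit_time_def)

lemma travel_le_before_exit:
  assumes "rectifiable_path \<gamma>" "0 \<le> r" "0 \<le> t" "t < exit_time \<gamma> r"
  shows "travel \<gamma> t \<le> r"
proof -
  obtain t' where "t < t'" "t' \<in> {0..1}" "travel \<gamma> t' \<le> r"
    using less_cSupD[of "{t \<in> {0..1}. travel \<gamma> t \<le> r}" t] exit_time_set[OF assms(2), of \<gamma>] assms(4)
    unfolding exit_time_def by blast
  then show ?thesis using travel_mono[OF assms(1), of t t'] by simp
qed

lemma travel_gt_after_exit:
  assumes "0 \<le> r" "exit_time \<gamma> r < t" "t \<le> 1"
  shows "r < travel \<gamma> t"
proof (rule ccontr)
  assume "\<not> r < travel \<gamma> t"
  then have "t \<in> {t \<in> {0..1}. travel \<gamma> t \<le> r}"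
    using assms exit_time_bounds(1)[of r \<gamma>] by simp
  then have "t \<le> exit_time \<gamma> r"
    unfolding exit_time_def by (rule cSup_upper) (rule exit_time_set[OF assms(1)])
  then show False using assms by simp
qed

lemma rectifiable_path_continuous_on:
  "rectifiable_path \<gamma> \<Longrightarrow> S \<subseteq> {0..1} \<Longrightarrow> continuous_on S \<gamma>"
  unfolding rectifiable_path_def path_def by (blast intro: continuous_on_subset)

lemma dist_le_until_exit:
  assumes \<gamma>: "rectifiable_path \<gamma>" and r: "0 \<le> r" and t: "0 \<le> t" "t \<le> exit_time \<gamma> r"
  shows "dist (\<gamma> 0) (\<gamma> t) \<le> r"
proof -
  let ?T = "exit_time \<gamma> r"
  have T: "0 \<le> ?T" "?T \<le> 1" using exit_time_bounds[OF r] by auto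
  have before: "dist (\<gamma> 0) (\<gamma> t) \<le> r" if "0 \<le> t" "t < ?T" for t
    using dist_le_travel[OF \<gamma>, of t] travel_le_before_exit[OF \<gamma> r that] that T by simp
  show ?thesis
  proof (cases "t < ?T \<or> t = 0")
    case True
    then show ?thesis using before t r by auto
  next
    case False
    then have tT: "t = ?T" "0 < ?T" using t by auto
    have "continuous_on {0..?T} (\<lambda>t. dist (\<gamma> 0) (\<gamma> t))"
      using T by (intro continuous_intros rectifiable_path_continuous_on[OF \<gamma>]) auto
    then have "((\<lambda>t. dist (\<gamma> 0) (\<gamma> t)) \<longlongrightarrow> dist (\<gamma> 0) (\<gamma> ?T)) (at_left ?T)"
      using tT by (intro continuous_on_Icc_at_leftD)
    moreover have "\<forall>\<^sub>F t in at_left ?T. dist (\<gamma> 0) (\<gamma> t) \<le> r"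
      using before tT(2) unfolding eventually_at_left[OF tT(2)] by (intro exI[of _ 0]) auto
    ultimately show ?thesis
      using tT by (metis tendsto_upperbound trivial_limit_at_left_real)
  qed
qed

text \<open>After the exit time the travelled length exceeds \<open>r\<close>, so the John condition
  gives \<open>r powr s\<close>; at an exit time below 1 a limit from the right is taken. If the
  exit time is 1 there is no later time, which is why the value at the endpoint enters through the
  minimum.\<close>

lemma infdist_ge_after_exit:
  assumes \<gamma>: "rectifiable_path \<gamma>" and r: "0 \<le> r" and t: "exit_time \<gamma> r \<le> t" "t \<le> 1" and s: "0 \<le> s"
    and john: "\<And>t. 0 < t \<Longrightarrow> t \<le> 1 \<Longrightarrow> travel \<gamma> t powr s \<le> C * infdist (\<gamma> t) F"
  shows "min (r powr s) (C * infdist (\<gamma> 1) F) \<le> C * infdist (\<gamma> t) F"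
proof -
  let ?T = "exit_time \<gamma> r"
  have T: "0 \<le> ?T" "?T \<le> 1" using exit_time_bounds[OF r] by auto
  have after: "r powr s \<le> C * infdist (\<gamma> t) F" if "?T < t" "t \<le> 1" for t
  proof -
    have "r powr s \<le> travel \<gamma> t powr s"
      using travel_gt_after_exit[OF r that] r s by (intro powr_mono2) auto
    also have "\<dots> \<le> C * infdist (\<gamma> t) F" using john[of t] that T by simp
    finally show ?thesis .
  qed
  consider "t = 1" | "?T < t" | "t = ?T" "?T < 1" using t by fastforce
  then show ?thesis
  proof cases
    case 2
    then show ?thesis using after[of t] t by simp
  next
    case 3
    have "continuous_on {?T..1} (\<lambda>t. C * infdist (\<gamma> t) F)"
      using T by (intro continuous_intros rectifiable_path_continuous_on[OF \<gamma>]) auto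
    then have "((\<lambda>t. C * infdist (\<gamma> t) F) \<longlongrightarrow> C * infdist (\<gamma> ?T) F) (at_right ?T)"
      using 3 by (intro continuous_on_Icc_at_rightD)
    moreover have "\<forall>\<^sub>F t in at_right ?T. r powr s \<le> C * infdist (\<gamma> t) F"
      using after 3 unfolding eventually_at_right[OF 3(2)] by (intro exI[of _ 1]) auto
    ultimately have "r powr s \<le> C * infdist (\<gamma> ?T) F"
      by (metis tendsto_lowerbound trivial_limit_at_right_real)
    then show ?thesis using 3 by simp
  qed simp
qed

text \<open>Of the additional 2, one unit comes from counting vertices instead of edges, the other
  from discarding the exit time itself, since \<open>travel_le_before_exit\<close> covers earlier
  times only.\<close>

lemma separated_card_le_until_exit:
  assumes \<gamma>: "rectifiable_path \<gamma>" and r: "0 \<le> r" and \<rho>: "0 < \<rho>"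
    and F: "F \<subseteq> \<gamma> ` {0..exit_time \<gamma> r}" "finite F" "pairwise (\<lambda>x y. \<rho> \<le> dist x y) F"
  shows "real (card F) \<le> r / \<rho> + 2"
proof -
  let ?T = "exit_time \<gamma> r"
  \<comment> \<open>One time is selected for each point of \<open>F\<close>.\<close>
  obtain S where S: "S \<subseteq> {0..?T}" "inj_on \<gamma> S" "F = \<gamma> ` S"
    using F(1) unfolding subset_image_inj by blast
  have finS: "finite S" using finite_imageD[of \<gamma> S] F(2) S by simp
  have sep: "\<rho> \<le> dist (\<gamma> t) (\<gamma> t')" if "t \<in> S" "t' \<in> S" "t \<noteq> t'" for t t'
    using F(3) S that unfolding pairwise_def by (auto simp: inj_on_eq_iff)
  have "real (card (S - {?T}) - 1) * \<rho> \<le> r"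
  proof (cases "S - {?T} = {}")
    case False
    \<comment> \<open>The polygon ends at the last remaining time, which lies strictly before the
      exit time.\<close>
    define t0 where "t0 = Max (S - {?T})"
    have t0: "t0 \<in> S - {?T}" "S - {?T} \<subseteq> {0..t0}"
      using Max_in[OF _ False] Max_ge[of "S - {?T}"] finS S(1) unfolding t0_def by (blast, fastforce)
    have "t0 < ?T" "0 \<le> t0" using t0(1) S(1) by (auto simp: order_less_le)
    have t01: "t0 \<le> 1" using \<open>t0 < ?T\<close> exit_time_bounds(2)[OF r, of \<gamma>] by simp
    have "ennreal (real (card (S - {?T}) - 1) * \<rho>) \<le> curve_length \<gamma> 0 t0"
      using finS t0(2) sep \<rho> by (intro separated_times_le_curve_length) auto
    then have "real (card (S - {?T}) - 1) * \<rho> \<le> travel \<gamma> t0"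
      unfolding rectifiable_travel[OF \<gamma> t01] by (simp add: ennreal_le_iff travel_nonneg)
    also have "\<dots> \<le> r" by (rule travel_le_before_exit[OF \<gamma> r \<open>0 \<le> t0\<close> \<open>t0 < ?T\<close>])
    finally show ?thesis .
  next
    case True
    then show ?thesis using r by (simp only: card.empty)
  qed
  then have "real (card (S - {?T}) - 1) \<le> r / \<rho>"
    using \<rho> by (simp add: field_simps)
  moreover have "card F \<le> card (S - {?T}) - 1 + 2"
    using card_image[OF S(2)] S(3) card_Diff_singleton_if[of S ?T] by (auto split: if_splits)
  ultimately show ?thesis by linarith
qed

text \<open>The ball is connected: if it meets \<Omega> without being contained in it, it meets the
  frontier.\<close>

lemma cball_subset_of_infdist_frontier:
  fixes z :: "'a::euclidean_space"
  assumes "z \<in> \<Omega>" "0 \<le> d" "d < infdist z (frontier \<Omega>)"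
  shows "cball z d \<subseteq> \<Omega>"
proof (rule ccontr)
  assume "\<not> cball z d \<subseteq> \<Omega>"
  then have "cball z d \<inter> frontier \<Omega> \<noteq> {}"
  proof (intro connected_Int_frontier)
    have "z \<in> cball z d \<inter> \<Omega>" using assms(1,2) by simp
    then show "cball z d \<inter> \<Omega> \<noteq> {}" by blast
  qed auto
  then obtain y where "y \<in> frontier \<Omega>" "dist z y \<le> d" by auto
  then show False using infdist_le[of y "frontier \<Omega>" z] assms by simp
qed

section \<open>One dyadic step along a John curve\<close>

lemma avg_diff_le_Lp:
  fixes a b :: "'a::euclidean_space"
  assumes wg: "weak_gradient \<Omega> u g" and u: "continuous_on \<Omega> u"
    and w: "set_integrable lebesgue \<Omega> (\<lambda>x. norm (g x) powr p)" and p: "1 \<le> p"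
    and K: "compact K" "convex K" "K \<subseteq> \<Omega>" "cball a r \<subseteq> K" "cball b r' \<subseteq> K"
    and r: "0 < r0" "r0 \<le> r" "r0 \<le> r'" and "0 < \<kappa>"
  shows "\<bar>avg \<Omega> u a r - avg \<Omega> u b r'\<bar> \<le> (dist a b + \<bar>r - r'\<bar>) / r0 ^ DIM('a) *
    (\<kappa> * measure lebesgue K + \<kappa> powr (1 - p) * (LINT x:K|lebesgue. norm (g x) powr p))"
proof -
  have "Lp_loc 1 \<Omega> g" using wg by (simp add: weak_gradient_def)
  from set_integral_norm_le[OF this w K(1,3) \<open>0 < \<kappa>\<close> p]
  have "(dist a b + \<bar>r - r'\<bar>) / r0 ^ DIM('a) * (LINT x:K|lebesgue. norm (g x)) \<le> (dist a b + \<bar>r - r'\<bar>) / r0 ^ DIM('a) *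
    (\<kappa> * measure lebesgue K + \<kappa> powr (1 - p) * (LINT x:K|lebesgue. norm (g x) powr p))"
    using r by (intro mult_left_mono) auto
  with avg_diff_le[OF wg u K r] show ?thesis by (rule order_trans)
qed

lemma set_integral_powr_mono:
  fixes A B :: "'a::euclidean_space set"
  assumes w: "set_integrable lebesgue \<Omega> (\<lambda>x. norm (g x) powr p)"
    and "A \<in> sets lebesgue" "B \<in> sets lebesgue" "A \<subseteq> B" "B \<subseteq> \<Omega>"
  shows "(LINT x:A|lebesgue. norm (g x) powr p) \<le> (LINT x:B|lebesgue. norm (g x) powr p)"
  unfolding set_lebesgue_integral_def
proof (rule integral_mono)
  show "integrable lebesgue (\<lambda>x. indicator A x *\<^sub>R norm (g x) powr p)"
    "integrable lebesgue (\<lambda>x. indicator B x *\<^sub>R norm (g x) powr p)"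
    using set_integrable_subset[OF w] assms(2-) unfolding set_integrable_def by blast+
qed (use assms(4) in \<open>auto simp: indicator_def\<close>)

text \<open>Two moves: between the exit points for \<open>R\<close> and \<open>R'\<close> with fixed
  radius \<rho>, then from radius \<rho> down to \<open>\<rho>'\<close> at a fixed centre. The bound
  \<open>b\<close> on the ratio of the radii keeps the constant independent of the scale. The radius
  \<open>4 * R\<close> is large enough because the piece of the curve stays within \<open>R\<close>
  of \<open>x\<close> and the balls used have radius \<open>2 * \<rho> \<le> 2 * R\<close>.\<close>

lemma avg_chain_step_le:
  fixes x :: "'a::euclidean_space" and \<gamma> :: "real \<Rightarrow> 'a"
  assumes \<Omega>: "open \<Omega>" and wg: "weak_gradient \<Omega> u g" and u: "continuous_on \<Omega> u"
    and w: "set_integrable lebesgue \<Omega> (\<lambda>x. norm (g x) powr p)" and p: "1 \<le> p"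
    and \<gamma>: "rectifiable_path \<gamma>" "\<gamma> 0 = x" "path_image \<gamma> \<subseteq> \<Omega>" and "0 < \<kappa>"
    and R: "0 \<le> R'" "R' \<le> R" and \<rho>: "0 < \<rho>'" "\<rho>' \<le> \<rho>" "\<rho> \<le> b * \<rho>'" "\<rho> \<le> R"
    and d: "\<And>t. exit_time \<gamma> R' \<le> t \<Longrightarrow> t \<le> 1 \<Longrightarrow> 2 * \<rho> < infdist (\<gamma> t) (frontier \<Omega>)"
  defines "v \<equiv> measure lebesgue (ball (0::'a) 1)"
  shows "\<bar>avg \<Omega> u (\<gamma> (exit_time \<gamma> R)) \<rho> - avg \<Omega> u (\<gamma> (exit_time \<gamma> R')) \<rho>'\<bar> \<le>
    (6 * 2 ^ DIM('a) * v + 2 * 5 ^ DIM('a) + b ^ DIM('a) * (v + 1)) *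
    (\<kappa> * R + \<kappa> powr (1 - p) * (\<rho> / \<rho> ^ DIM('a) * (LINT y:\<Omega> \<inter> ball x (4 * R)|lebesgue. norm (g y) powr p)))"
proof -
  define G where "G = (LINT y:\<Omega> \<inter> ball x (4 * R)|lebesgue. norm (g y) powr p)"
  define X where "X = \<kappa> * R"
  define Y where "Y = \<kappa> powr (1 - p) * (\<rho> / \<rho> ^ DIM('a) * G)"
  let ?T = "exit_time \<gamma>"
  have R0: "0 \<le> R" "0 < R" and \<rho>0: "0 < \<rho>" using R \<rho> by auto
  have T: "0 \<le> ?T R'" "?T R' \<le> ?T R" "?T R \<le> 1"
    using exit_time_bounds[of _ \<gamma>] exit_time_mono[OF R] R R0 by auto
  have v: "0 \<le> v" by (simp add: v_def)
  have A: "\<Omega> \<inter> ball x (4 * R) \<in> sets lebesgue" "\<Omega> \<inter> ball x (4 * R) \<subseteq> \<Omega>"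
    using \<Omega> by (auto intro!: sets_completionI_sets borel_open open_Int)
  have G0: "0 \<le> G"
    unfolding G_def set_lebesgue_integral_def by (intro Bochner_Integration.integral_nonneg) auto
  have ball: "cball (\<gamma> t) (2 * \<rho>) \<subseteq> \<Omega> \<inter> ball x (4 * R)" if t: "t \<in> {?T R'..?T R}" for t
  proof -
    have "\<gamma> t \<in> \<Omega>" using \<gamma>(3) t T by (auto simp: path_image_def)
    then have "cball (\<gamma> t) (2 * \<rho>) \<subseteq> \<Omega>"
      using d[of t] t T \<rho>0 by (intro cball_subset_of_infdist_frontier) auto
    moreover have "dist x (\<gamma> t) \<le> R"
      using dist_le_until_exit[OF \<gamma>(1) R0(1), of t] \<gamma>(2) t T by simp
    then have "cball (\<gamma> t) (2 * \<rho>) \<subseteq> ball x (4 * R)"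
      using \<rho>(4) R0(2) by (auto simp: cball_subset_ball_iff dist_commute)
    ultimately show ?thesis by blast
  qed
  \<comment> \<open>A separated set on the piece has at most \<open>R / \<rho> + 2\<close> points,
    and \<open>\<rho> \<le> R\<close> absorbs the 2.\<close>
  define M where "M = 3 * R / \<rho>"
  have "\<bar>avg \<Omega> u (\<gamma> (?T R)) \<rho> - avg \<Omega> u (\<gamma> (?T R')) \<rho>\<bar> \<le> 2 * (\<rho> / \<rho> ^ DIM('a)) *
    (\<kappa> * (M * ((2 * \<rho>) ^ DIM('a) * measure lebesgue (ball (0::'a) 1))) + \<kappa> powr (1 - p) * (5 ^ DIM('a) * G))"
    unfolding G_def
  proof (rule avg_diff_connected_le[OF wg u w p _ \<rho>0 \<open>0 < \<kappa>\<close> A, where \<Gamma> = "\<gamma> ` {?T R'..?T R}"])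
    show "connected (\<gamma> ` {?T R'..?T R})"
      using T by (intro connected_continuous_image rectifiable_path_continuous_on[OF \<gamma>(1)]) auto
    show "cball z (2 * \<rho>) \<subseteq> \<Omega> \<inter> ball x (4 * R)" if "z \<in> \<gamma> ` {?T R'..?T R}" for z
      using that ball by blast
    show "real (card F) \<le> M"
      if "F \<subseteq> \<gamma> ` {?T R'..?T R}" "finite F" "pairwise (\<lambda>x y. \<rho> \<le> dist x y) F" for F
    proof -
      have "F \<subseteq> \<gamma> ` {0..?T R}"
        using that(1) image_mono[of "{?T R'..?T R}" "{0..?T R}" \<gamma>] T by auto
      then have "real (card F) \<le> R / \<rho> + 2"
        using that \<rho>0 R0 by (intro separated_card_le_until_exit[OF \<gamma>(1)]) auto
      also have "\<dots> \<le> M" using \<rho> \<rho>0 by (simp add: M_def field_simps)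
      finally show ?thesis .
    qed
  qed (use T in auto)
  also have "\<dots> = 6 * 2 ^ DIM('a) * v * X + 2 * 5 ^ DIM('a) * Y"
    using \<rho>0 by (simp add: M_def v_def X_def Y_def field_simps power_mult_distrib)
  finally have 1: "\<bar>avg \<Omega> u (\<gamma> (?T R)) \<rho> - avg \<Omega> u (\<gamma> (?T R')) \<rho>\<bar> \<le> 6 * 2 ^ DIM('a) * v * X + 2 * 5 ^ DIM('a) * Y" .
  have sub: "cball (\<gamma> (?T R')) \<rho> \<subseteq> \<Omega> \<inter> ball x (4 * R)"
    using subset_trans[OF subset_cball ball[of "?T R'"], of \<rho>] T \<rho>0 by simp
  define GK where "GK = (LINT y:cball (\<gamma> (?T R')) \<rho>|lebesgue. norm (g y) powr p)"
  have GK: "GK \<le> G"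
    unfolding G_def GK_def using sub A by (intro set_integral_powr_mono[OF w]) auto
  have b1: "1 \<le> b" using \<rho> \<rho>0 by (smt (verit, ccfv_SIG) mult_le_cancel_right1)
  have "\<bar>avg \<Omega> u (\<gamma> (?T R')) \<rho> - avg \<Omega> u (\<gamma> (?T R')) \<rho>'\<bar> \<le>
    (dist (\<gamma> (?T R')) (\<gamma> (?T R')) + \<bar>\<rho> - \<rho>'\<bar>) / \<rho>' ^ DIM('a) *
    (\<kappa> * measure lebesgue (cball (\<gamma> (?T R')) \<rho>) + \<kappa> powr (1 - p) * GK)"
    unfolding GK_def using sub \<rho>
    by (intro avg_diff_le_Lp[OF wg u w p _ _ _ _ _ _ _ _ \<open>0 < \<kappa>\<close>]) (auto simp: cball_subset_cball_iff)
  also have "\<dots> \<le> \<rho> * b ^ DIM('a) / \<rho> ^ DIM('a) * (\<kappa> * (\<rho> ^ DIM('a) * v) + \<kappa> powr (1 - p) * G)"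
  proof (rule mult_mono)
    have "(dist (\<gamma> (?T R')) (\<gamma> (?T R')) + \<bar>\<rho> - \<rho>'\<bar>) / \<rho>' ^ DIM('a) \<le> \<rho> / \<rho>' ^ DIM('a)"
      using \<rho> by (intro divide_right_mono) auto
    also have "\<dots> \<le> \<rho> * b ^ DIM('a) / \<rho> ^ DIM('a)"
    proof -
      have "\<rho> ^ DIM('a) \<le> b ^ DIM('a) * \<rho>' ^ DIM('a)"
        using \<rho> \<rho>0 by (simp flip: power_mult_distrib add: power_mono)
      then show ?thesis using \<rho> \<rho>0 by (simp add: divide_simps mult.commute)
    qed
    finally show "(dist (\<gamma> (?T R')) (\<gamma> (?T R')) + \<bar>\<rho> - \<rho>'\<bar>) / \<rho>' ^ DIM('a) \<le> \<rho> * b ^ DIM('a) / \<rho> ^ DIM('a)" .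
    show "\<kappa> * measure lebesgue (cball (\<gamma> (?T R')) \<rho>) + \<kappa> powr (1 - p) * GK
        \<le> \<kappa> * (\<rho> ^ DIM('a) * v) + \<kappa> powr (1 - p) * G"
      using GK \<rho>0 by (simp add: content_cball_conv_ball content_ball_conv_unit_ball[where r = \<rho>] v_def mult_left_mono)
    show "0 \<le> \<kappa> * measure lebesgue (cball (\<gamma> (?T R')) \<rho>) + \<kappa> powr (1 - p) * GK"
      unfolding GK_def set_lebesgue_integral_def using \<open>0 < \<kappa>\<close>
      by (intro add_nonneg_nonneg mult_nonneg_nonneg Bochner_Integration.integral_nonneg) auto
  qed (use b1 \<rho>0 in auto)
  also have "\<dots> = b ^ DIM('a) * (v * (\<kappa> * \<rho>) + Y)"
    using \<rho>0 by (simp add: Y_def field_simps)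
  also have "\<dots> \<le> b ^ DIM('a) * (v * X + Y)"
    using \<rho>(4) v b1 \<open>0 < \<kappa>\<close> by (intro mult_left_mono add_mono) (auto simp: X_def)
  finally have 2: "\<bar>avg \<Omega> u (\<gamma> (?T R')) \<rho> - avg \<Omega> u (\<gamma> (?T R')) \<rho>'\<bar> \<le> b ^ DIM('a) * (v * X + Y)" .
  have XY: "0 \<le> X" "0 \<le> Y"
    using \<open>0 < \<kappa>\<close> R0 \<rho>0 G0 by (auto simp: X_def Y_def)
  \<comment> \<open>Nonnegative cross terms are added so that both errors carry the same
    constant.\<close>
  have "(6 * 2 ^ DIM('a) * v + 2 * 5 ^ DIM('a) + b ^ DIM('a) * (v + 1)) * (X + Y)
      = (6 * 2 ^ DIM('a) * v * X + 2 * 5 ^ DIM('a) * Y + b ^ DIM('a) * (v * X + Y))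
        + (6 * 2 ^ DIM('a) * v * Y + 2 * 5 ^ DIM('a) * X + b ^ DIM('a) * (v * Y + X))"
    by (simp add: algebra_simps)
  moreover have "0 \<le> 6 * 2 ^ DIM('a) * v * Y + 2 * 5 ^ DIM('a) * X + b ^ DIM('a) * (v * Y + X)"
    using XY v b1 by auto
  ultimately show ?thesis
    using 1 2 unfolding X_def[symmetric] Y_def[symmetric] G_def[symmetric] by linarith
qed

section \<open>Lower density of the energy\<close>

lemma powr_scale_power:
  fixes a :: real
  assumes "0 < a" shows "(a / 2 ^ k) powr s = a powr s * (2 powr - s) ^ k"
proof -
  have "((2::real) ^ k) powr s = (2 powr s) ^ k"
    by (simp add: powr_powr mult.commute flip: powr_realpow)
  moreover have "(a / 2 ^ k) powr s = a powr s / (2 ^ k) powr s"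
    using assms by (simp add: powr_divide)
  ultimately show ?thesis by (simp add: powr_minus divide_inverse power_inverse)
qed

text \<open>The weights \<open>\<kappa> = \<mu> R\<^sub>k powr (\<epsilon> / p - 1)\<close> make both error terms of step \<open>k\<close> a multiple
  of \<open>R\<^sub>k powr (\<epsilon> / p)\<close>, which is summable.\<close>

lemma chain_density:
  fixes R \<rho>\<^sub>0 s p \<epsilon> C\<^sub>1 C\<^sub>2 V :: real and n :: nat
  assumes R: "0 < R" and \<rho>\<^sub>0: "0 < \<rho>\<^sub>0" and p: "1 \<le> p" and \<epsilon>: "0 < \<epsilon>" and C: "0 < C\<^sub>1" "0 \<le> C\<^sub>2" and V: "0 < V"
  defines "\<alpha> \<equiv> s * (real n - 1) + 1 - p + \<epsilon>"
    and "r \<equiv> \<lambda>k. R / 2 ^ k" and "\<rho> \<equiv> \<lambda>k. \<rho>\<^sub>0 * (2 powr - s) ^ k"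
  shows "\<exists>\<delta>>0. \<forall>A B G. V \<le> B \<longrightarrow> (\<exists>N. A N \<le> V / 4) \<longrightarrow>
    (\<forall>\<kappa>>0. \<forall>k. \<bar>A k - A (Suc k)\<bar> \<le> C\<^sub>1 * (\<kappa> * r k + \<kappa> powr (1 - p) * (\<rho> k / \<rho> k ^ n * G k))) \<longrightarrow>
    (\<forall>\<kappa>>0. \<bar>B - A 0\<bar> \<le> C\<^sub>2 * (\<kappa> * r 0 + \<kappa> powr (1 - p) * (\<rho> 0 / \<rho> 0 ^ n * G 0))) \<longrightarrow>
    (\<exists>k. \<delta> * r k powr \<alpha> \<le> G k)"
proof -
  \<comment> \<open>\<theta> is the ratio of the geometric sequence
    \<open>r k powr (\<epsilon> / p)\<close>, and \<open>c\<close> is the ratio of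
    \<open>\<rho> k\<close> to \<open>r k powr s\<close>. The choice of \<mu> makes the bound
    \<open>2 * \<mu> * C\<^sub>3\<close> on the total change equal to \<open>V / 2\<close>; the
    choice of \<delta> makes \<open>\<mu> powr (1 - p) * c powr (1 - real n) * \<delta>\<close>
    equal to \<mu>.\<close>
  define \<theta> where "\<theta> = 2 powr - (\<epsilon> / p)"
  define C\<^sub>3 where "C\<^sub>3 = (C\<^sub>1 / (1 - \<theta>) + C\<^sub>2) * R powr (\<epsilon> / p)"
  define c where "c = \<rho>\<^sub>0 / R powr s"
  define \<mu> where "\<mu> = V / (4 * C\<^sub>3)"
  define \<delta> where "\<delta> = \<mu> / (\<mu> powr (1 - p) * c powr (1 - real n))"
  have \<theta>: "0 < \<theta>" "\<theta> < 1"
    using \<epsilon> p powr_less_mono[of "- (\<epsilon> / p)" 0 2] by (auto simp: \<theta>_def)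
  have C3: "0 < C\<^sub>3" using \<theta> C R by (auto simp: C\<^sub>3_def intro!: mult_pos_pos add_pos_nonneg divide_pos_pos)
  have c: "0 < c" using R \<rho>\<^sub>0 by (simp add: c_def)
  have \<mu>: "0 < \<mu>" using V C3 by (simp add: \<mu>_def)
  have \<delta>: "0 < \<delta>" using \<mu> c by (simp add: \<delta>_def)
  have r: "0 < r k" for k using R by (simp add: r_def)
  have \<rho>: "\<rho> k = c * r k powr s" "0 < \<rho> k" for k
    using powr_scale_power[OF R, of k s] R \<rho>\<^sub>0 by (auto simp: \<rho>_def c_def r_def)
  have r\<theta>: "r k powr (\<epsilon> / p) = R powr (\<epsilon> / p) * \<theta> ^ k" for k
    unfolding r_def \<theta>_def by (rule powr_scale_power[OF R])
  show ?thesis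
  proof (intro exI[of _ \<delta>] conjI \<delta> allI impI, rule ccontr)
    fix A G :: "nat \<Rightarrow> real" and B
    assume VB: "V \<le> B" and "\<exists>N. A N \<le> V / 4"
      and step: "\<forall>\<kappa>>0. \<forall>k. \<bar>A k - A (Suc k)\<bar> \<le> C\<^sub>1 * (\<kappa> * r k + \<kappa> powr (1 - p) * (\<rho> k / \<rho> k ^ n * G k))"
      and top: "\<forall>\<kappa>>0. \<bar>B - A 0\<bar> \<le> C\<^sub>2 * (\<kappa> * r 0 + \<kappa> powr (1 - p) * (\<rho> 0 / \<rho> 0 ^ n * G 0))"
      and "\<not> (\<exists>k. \<delta> * r k powr \<alpha> \<le> G k)"
    then have G: "G k \<le> \<delta> * r k powr \<alpha>" for k by (simp add: not_le less_imp_le)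
    obtain N where N: "A N \<le> V / 4" using \<open>\<exists>N. A N \<le> V / 4\<close> by blast
    define \<kappa> where "\<kappa> k = \<mu> * r k powr (\<epsilon> / p - 1)" for k
    have \<kappa>: "0 < \<kappa> k" for k using \<mu> r[of k] by (simp add: \<kappa>_def)
    have bound: "\<kappa> k * r k + \<kappa> k powr (1 - p) * (\<rho> k / \<rho> k ^ n * G k) \<le> 2 * \<mu> * r k powr (\<epsilon> / p)" for k
    proof -
      have 1: "\<kappa> k * r k = \<mu> * r k powr (\<epsilon> / p)"
        using r[of k] powr_add[of "r k" "\<epsilon> / p - 1" 1] by (simp add: \<kappa>_def)
      have "\<kappa> k powr (1 - p) * (\<rho> k / \<rho> k ^ n * G k) \<le> \<kappa> k powr (1 - p) * (\<rho> k / \<rho> k ^ n * (\<delta> * r k powr \<alpha>))"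
        using \<rho>(2)[of k] G by (intro mult_left_mono) auto
      also have "\<dots> = \<mu> * r k powr (\<epsilon> / p)"
      proof -
        have "\<rho> k / \<rho> k ^ n = \<rho> k powr (1 - real n)"
          using \<rho>(2)[of k] by (simp add: powr_diff powr_realpow)
        also have "\<dots> = c powr (1 - real n) * r k powr (s * (1 - real n))"
          using c r[of k] by (simp add: \<rho>(1) powr_mult powr_powr)
        finally have \<rho>n: "\<rho> k / \<rho> k ^ n = c powr (1 - real n) * r k powr (s * (1 - real n))" .
        have \<kappa>p: "\<kappa> k powr (1 - p) = \<mu> powr (1 - p) * r k powr ((\<epsilon> / p - 1) * (1 - p))"
          using \<mu> r[of k] by (simp add: \<kappa>_def powr_mult powr_powr)
        \<comment> \<open>The value of \<alpha> is dictated by this exponent count.\<close>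
        have "(\<epsilon> / p - 1) * (1 - p) + s * (1 - real n) + \<alpha> = \<epsilon> / p"
          using p by (simp add: \<alpha>_def field_simps)
        then have "r k powr ((\<epsilon> / p - 1) * (1 - p)) * r k powr (s * (1 - real n)) * r k powr \<alpha> = r k powr (\<epsilon> / p)"
          by (simp flip: powr_add)
        moreover have "\<mu> powr (1 - p) * c powr (1 - real n) * \<delta> = \<mu>"
          using \<mu> c by (simp add: \<delta>_def)
        ultimately have "\<mu> * r k powr (\<epsilon> / p) = (\<mu> powr (1 - p) * c powr (1 - real n) * \<delta>) *
            (r k powr ((\<epsilon> / p - 1) * (1 - p)) * r k powr (s * (1 - real n)) * r k powr \<alpha>)"
          by simp
        then show ?thesis unfolding \<rho>n \<kappa>p by (simp only: mult_ac)
      qed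
      finally show ?thesis using 1 by linarith
    qed
    have "\<bar>A 0 - A m\<bar> \<le> C\<^sub>1 * (2 * \<mu> * R powr (\<epsilon> / p)) * (\<Sum>k<m. \<theta> ^ k)" for m
    proof (induction m)
      case (Suc m)
      have "\<bar>A m - A (Suc m)\<bar> \<le> C\<^sub>1 * (\<kappa> m * r m + \<kappa> m powr (1 - p) * (\<rho> m / \<rho> m ^ n * G m))"
        using step \<kappa> by blast
      also have "\<dots> \<le> C\<^sub>1 * (2 * \<mu> * r m powr (\<epsilon> / p))"
        using bound C by (intro mult_left_mono) auto
      finally have "\<bar>A m - A (Suc m)\<bar> \<le> C\<^sub>1 * (2 * \<mu> * R powr (\<epsilon> / p)) * \<theta> ^ m"
        by (simp add: r\<theta> mult_ac)
      with Suc.IH show ?case by (simp add: distrib_left)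
    qed simp
    also have "C\<^sub>1 * (2 * \<mu> * R powr (\<epsilon> / p)) * (\<Sum>k<m. \<theta> ^ k) \<le> C\<^sub>1 * (2 * \<mu> * R powr (\<epsilon> / p)) * (1 / (1 - \<theta>))" for m
    proof (intro mult_left_mono)
      have "(\<Sum>k<m. \<theta> ^ k) \<le> (\<Sum>k. \<theta> ^ k)"
        using \<theta> by (intro sum_le_suminf summable_geometric) auto
      then show "(\<Sum>k<m. \<theta> ^ k) \<le> 1 / (1 - \<theta>)"
        using \<theta> by (simp add: suminf_geometric)
    qed (use C \<mu> in auto)
    finally have chain: "\<bar>A 0 - A N\<bar> \<le> C\<^sub>1 * (2 * \<mu> * R powr (\<epsilon> / p)) * (1 / (1 - \<theta>))" .
    have "\<bar>B - A 0\<bar> \<le> C\<^sub>2 * (\<kappa> 0 * r 0 + \<kappa> 0 powr (1 - p) * (\<rho> 0 / \<rho> 0 ^ n * G 0))"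
      using top \<kappa> by blast
    also have "\<dots> \<le> C\<^sub>2 * (2 * \<mu> * r 0 powr (\<epsilon> / p))"
      using bound C by (intro mult_left_mono) auto
    also have "\<dots> = C\<^sub>2 * (2 * \<mu> * R powr (\<epsilon> / p))" by (simp add: r_def)
    finally have "\<bar>B - A N\<bar> \<le> C\<^sub>1 * (2 * \<mu> * R powr (\<epsilon> / p)) * (1 / (1 - \<theta>)) + C\<^sub>2 * (2 * \<mu> * R powr (\<epsilon> / p))"
      using chain by linarith
    also have "\<dots> = 2 * \<mu> * C\<^sub>3" by (simp add: C\<^sub>3_def algebra_simps)
    also have "\<dots> = V / 2" using C3 by (simp add: \<mu>_def)
    \<comment> \<open>\<open>B\<close> and \<open>A N\<close> differ by at least
      \<open>3 * V / 4\<close>, which exceeds the bound \<open>V / 2\<close>.\<close>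
    finally show False using VB N V by linarith
  qed
qed

section \<open>Balls and convex neighbourhoods for the central cube\<close>

lemma cube_center:
  fixes Q :: "'a::euclidean_space set"
  assumes "axis_parallel_cube Q"
  obtains c l where "0 < l" "c \<in> Q" "cball c l \<subseteq> Q" "compact Q" "convex Q"
proof -
  obtain a l where l: "0 < l" and Q: "Q = cbox a (a + l *\<^sub>R One)"
    using assms unfolding axis_parallel_cube_def by blast
  define c where "c = a + (l / 2) *\<^sub>R One"
  have "cball c (l / 2) \<subseteq> Q"
  proof
    fix y assume "y \<in> cball c (l / 2)"
    then have y: "norm (y - c) \<le> l / 2" by (simp add: dist_norm norm_minus_commute)
    show "y \<in> Q"
      unfolding Q mem_box
    proof
      fix i :: 'a assume i: "i \<in> Basis"
      have "(y - c) \<bullet> i \<le> l / 2" "- (l / 2) \<le> (y - c) \<bullet> i"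
        using Basis_le_norm[OF i, of "y - c"] y by linarith+
      then show "a \<bullet> i \<le> y \<bullet> i \<and> y \<bullet> i \<le> (a + l *\<^sub>R One) \<bullet> i"
        using i by (simp add: c_def inner_simps)
    qed
  qed
  moreover from this have "c \<in> Q" using l by auto
  moreover have "compact Q" "convex Q" unfolding Q by (rule compact_cbox convex_box)+
  ultimately show ?thesis using that[of "l / 2" c] l by simp
qed

text \<open>\<open>K\<close> is the Minkowski sum of \<open>Q\<close> and a small ball. The John
  centre may lie on the boundary of the central cube, so a ball about it can stick out of the cube;
  the comparison with a ball inside the cube takes place in \<open>K\<close>.\<close>

lemma compact_convex_neighbourhood:
  fixes Q :: "'a::euclidean_space set"
  assumes "compact Q" "convex Q" "Q \<subseteq> \<Omega>" "open \<Omega>"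
  obtains \<eta> K where "0 < \<eta>" "compact K" "convex K" "K \<subseteq> \<Omega>" "\<And>x. x \<in> Q \<Longrightarrow> cball x \<eta> \<subseteq> K"
proof -
  obtain \<eta> where \<eta>: "0 < \<eta>" "(\<Union>x\<in>Q. cball x \<eta>) \<subseteq> \<Omega>"
    using compact_subset_open_imp_cball_epsilon_subset[OF assms(1,4,3)] by blast
  define K where "K = {x + y | x y. x \<in> Q \<and> y \<in> cball 0 \<eta>}"
  have K: "K = (\<Union>x\<in>Q. \<Union>y\<in>cball 0 \<eta>. {x + y})" unfolding K_def by blast
  have "compact K" unfolding K_def using assms(1) by (intro compact_sums) auto
  moreover have "convex K" unfolding K using assms(2) by (intro convex_sums) auto
  moreover have "K \<subseteq> \<Omega>"
  proof
    fix z assume "z \<in> K"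
    then obtain x y where "x \<in> Q" "y \<in> cball 0 \<eta>" "z = x + y" by (auto simp: K_def)
    then have "z \<in> cball x \<eta>" by (simp add: dist_norm)
    then show "z \<in> \<Omega>" using \<eta>(2) \<open>x \<in> Q\<close> by blast
  qed
  moreover have "cball x \<eta> \<subseteq> K" if "x \<in> Q" for x
  proof
    fix z assume "z \<in> cball x \<eta>"
    then have "z = x + (z - x)" "z - x \<in> cball 0 \<eta>" by (auto simp: dist_norm norm_minus_commute)
    then show "z \<in> K" unfolding K_def using that by blast
  qed
  ultimately show ?thesis using \<eta>(1) that by blast
qed

text \<open>\<open>chain_density\<close> is applied to the averages at the exit points for the radii
  \<open>R / 2 ^ k\<close>, which start at \<open>x\<^sub>0\<close> and approach \<open>x\<close>.
  The constants \<open>R\<close> and \<delta> come before \<open>u\<close>, \<open>g\<close> and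
  \<open>x\<close> in the quantifier order, so one pair serves all admissible functions and all
  points.\<close>

lemma John_density:
  fixes \<Omega> Q :: "'a::euclidean_space set"
  assumes s: "1 \<le> s" and john: "s_John_domain s C\<^sub>0 x\<^sub>0 \<Omega>"
    and Q: "axis_parallel_cube Q" "Q \<subseteq> \<Omega>" "x\<^sub>0 \<in> Q"
    and \<epsilon>: "0 < \<epsilon>" and p: "1 \<le> p"
  defines "\<alpha> \<equiv> s * (real DIM('a) - 1) + 1 - p + \<epsilon>"
  shows "\<exists>R>0. \<exists>\<delta>>0. \<forall>u g x. continuous_on \<Omega> u \<longrightarrow> weak_gradient \<Omega> u g \<longrightarrow>
    set_integrable lebesgue \<Omega> (\<lambda>y. norm (g y) powr p) \<longrightarrow> (\<forall>y\<in>Q. 1 \<le> u y) \<longrightarrow> x \<in> \<Omega> \<longrightarrow> u x \<le> 0 \<longrightarrow>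
    (\<exists>k. \<delta> * (R / 2 ^ k) powr \<alpha> \<le> (LINT y:\<Omega> \<inter> ball x (4 * (R / 2 ^ k))|lebesgue. norm (g y) powr p))"
proof -
  have \<Omega>: "open \<Omega>" "\<Omega> \<noteq> {}" "bounded \<Omega>" and C0: "0 < C\<^sub>0" and x0: "x\<^sub>0 \<in> \<Omega>"
    using john unfolding s_John_domain_def bounded_domain_def by auto
  define d0 where "d0 = infdist x\<^sub>0 (frontier \<Omega>)"
  have "frontier \<Omega> \<noteq> {}"
    using \<Omega> not_bounded_UNIV[where 'a = 'a] by (auto simp: frontier_eq_empty)
  then have d0: "0 < d0"
    unfolding d0_def using x0 \<Omega>(1) by (intro infdist_pos_not_in_closed) (auto simp: frontier_def interior_open)
  obtain B where B: "\<And>x. x \<in> \<Omega> \<Longrightarrow> norm x \<le> B" using \<Omega>(3) unfolding bounded_iff by blast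
  obtain c0 l where c0: "0 < l" "c0 \<in> Q" "cball c0 l \<subseteq> Q" and Qc: "compact Q" "convex Q"
    using cube_center[OF Q(1)] by blast
  obtain \<eta> K where \<eta>: "0 < \<eta>" and K: "compact K" "convex K" "K \<subseteq> \<Omega>" "\<And>x. x \<in> Q \<Longrightarrow> cball x \<eta> \<subseteq> K"
    using compact_convex_neighbourhood[OF Qc Q(2) \<Omega>(1)] by blast
  \<comment> \<open>The John condition at time 1 bounds the length of every curve by the first
    entry, so the exit point for \<open>r 0\<close> is the John centre. The second entry makes the
    ball of radius \<open>4 * R\<close> about any point of \<Omega> contain \<Omega>.\<close>
  define R where "R = max ((C\<^sub>0 * d0) powr (1 / s)) (\<bar>B\<bar> + 1)"
  \<comment> \<open>\<open>R\<close> ensures \<open>\<rho> k \<le> r k\<close>, \<eta> keeps the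
    balls about \<open>c0\<close> and \<open>x\<^sub>0\<close> in \<open>K\<close>, and
    \<open>l\<close> keeps the ball about \<open>c0\<close> in the cube. The entry
    \<open>d0 / 4\<close> and the last one serve the distance bound \<open>far\<close>; the factor
    \<open>2 powr s\<close> pays for passing from \<open>r k\<close> to
    \<open>r (Suc k)\<close>.\<close>
  define \<rho>\<^sub>0 where "\<rho>\<^sub>0 = Min {R, d0 / 4, \<eta>, l, R powr s / (4 * C\<^sub>0 * 2 powr s)}"
  define r where "r k = R / 2 ^ k" for k
  define \<rho> where "\<rho> k = \<rho>\<^sub>0 * (2 powr - s) ^ k" for k
  define V where "V = (LINT y|lebesgue. mol (0::'a) 1 y)"
  define v where "v = measure lebesgue (ball (0::'a) 1)"
  define C\<^sub>1 where "C\<^sub>1 = 6 * 2 ^ DIM('a) * v + 2 * 5 ^ DIM('a) + (2 powr s) ^ DIM('a) * (v + 1)"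
  \<comment> \<open>The two summands in the bracket turn the volume of \<open>K\<close> into a
    multiple of \<open>R\<close>, and a plain energy into one with the factor
    \<open>\<rho>\<^sub>0 / \<rho>\<^sub>0 ^ DIM('a)\<close>, as \<open>chain_density\<close>
    expects.\<close>
  define C\<^sub>2 where "C\<^sub>2 = dist c0 x\<^sub>0 / \<rho>\<^sub>0 ^ DIM('a) * (measure lebesgue K / R + \<rho>\<^sub>0 ^ DIM('a) / \<rho>\<^sub>0)"
  have R: "0 < R" by (auto simp: R_def)
  have \<rho>0: "0 < \<rho>\<^sub>0" "\<rho>\<^sub>0 \<le> R" "\<rho>\<^sub>0 \<le> d0 / 4" "\<rho>\<^sub>0 \<le> \<eta>" "\<rho>\<^sub>0 \<le> l" "\<rho>\<^sub>0 \<le> R powr s / (4 * C\<^sub>0 * 2 powr s)"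
    using R d0 \<eta> c0 C0 unfolding \<rho>\<^sub>0_def by auto
  have v: "0 \<le> v" by (simp add: v_def)
  have C1: "0 < C\<^sub>1" using v unfolding C\<^sub>1_def by (intro add_pos_nonneg add_nonneg_pos) auto
  have C2: "0 \<le> C\<^sub>2" using R \<rho>0 by (simp add: C\<^sub>2_def)
  have V: "0 < V" unfolding V_def by (rule integral_mol_pos)
  obtain \<delta> where \<delta>: "0 < \<delta>" "\<forall>A B G. V \<le> B \<longrightarrow> (\<exists>N. A N \<le> V / 4) \<longrightarrow>
    (\<forall>\<kappa>>0. \<forall>k. \<bar>A k - A (Suc k)\<bar> \<le> C\<^sub>1 * (\<kappa> * r k + \<kappa> powr (1 - p) * (\<rho> k / \<rho> k ^ DIM('a) * G k))) \<longrightarrow>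
    (\<forall>\<kappa>>0. \<bar>B - A 0\<bar> \<le> C\<^sub>2 * (\<kappa> * r 0 + \<kappa> powr (1 - p) * (\<rho> 0 / \<rho> 0 ^ DIM('a) * G 0))) \<longrightarrow>
    (\<exists>k. \<delta> * r k powr \<alpha> \<le> G k)"
    using chain_density[OF R \<rho>0(1) p \<epsilon> C1 C2 V, of s "DIM('a)"] unfolding r_def \<rho>_def \<alpha>_def by blast
  have rpos: "0 < r k" for k using R by (simp add: r_def)
  have rmono: "r (Suc k) \<le> r k" for k using R by (simp add: r_def field_simps)
  have \<beta>: "0 < 2 powr - s" "2 powr - s \<le> 1 / 2"
    using s powr_mono[of "- s" "- 1" 2] by (auto simp: powr_minus)
  have \<rho>pos: "0 < \<rho> k" for k using \<rho>0 \<beta> by (simp add: \<rho>_def)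
  have \<rho>Suc: "\<rho> k = 2 powr s * \<rho> (Suc k)" for k
    by (simp add: \<rho>_def powr_minus)
  have \<rho>le: "\<rho> (Suc k) \<le> \<rho> k" for k
  proof -
    have "\<rho> (Suc k) = 2 powr - s * \<rho> k" by (simp add: \<rho>_def)
    also have "\<dots> \<le> 1 * \<rho> k" using \<beta> \<rho>pos[of k] by (intro mult_right_mono) auto
    finally show ?thesis by simp
  qed
  have \<rho>\<rho>0: "\<rho> k \<le> \<rho>\<^sub>0" for k
    using \<rho>0(1) \<beta> by (simp add: \<rho>_def power_le_one)
  have \<rho>r: "\<rho> k \<le> r k" for k
  proof -
    have "\<rho> k \<le> R * (1 / 2) ^ k"
      unfolding \<rho>_def using \<rho>0 \<beta> R by (intro mult_mono power_mono) auto
    then show ?thesis by (simp add: r_def power_one_over)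
  qed
  show ?thesis
  proof (rule exI[of _ R], rule conjI[OF R], rule exI[of _ \<delta>], rule conjI[OF \<delta>(1)], intro allI impI)
    fix u :: "'a \<Rightarrow> real" and g x
    assume u: "continuous_on \<Omega> u" and wg: "weak_gradient \<Omega> u g"
      and w: "set_integrable lebesgue \<Omega> (\<lambda>y. norm (g y) powr p)"
      and uQ: "\<forall>y\<in>Q. 1 \<le> u y" and x: "x \<in> \<Omega>" "u x \<le> 0"
    define G where "G k = (LINT y:\<Omega> \<inter> ball x (4 * r k)|lebesgue. norm (g y) powr p)" for k
    obtain \<gamma> where \<gamma>: "rectifiable_path \<gamma>" "path_image \<gamma> \<subseteq> \<Omega>" "\<gamma> 0 = x" "\<gamma> 1 = x\<^sub>0"
      and jt: "\<And>t. 0 < t \<Longrightarrow> t \<le> 1 \<Longrightarrow> travel \<gamma> t powr s \<le> C\<^sub>0 * infdist (\<gamma> t) (frontier \<Omega>)"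
      using john x(1) unfolding s_John_domain_def pathstart_def pathfinish_def travel_def by blast
    define a where "a k = \<gamma> (exit_time \<gamma> (r k))" for k
    have "travel \<gamma> 1 powr s \<le> C\<^sub>0 * d0" using jt[of 1] \<gamma>(4) by (simp add: d0_def)
    then have "(travel \<gamma> 1 powr s) powr (1 / s) \<le> (C\<^sub>0 * d0) powr (1 / s)"
      using s by (intro powr_mono2) auto
    then have "travel \<gamma> 1 \<le> r 0"
      using s travel_nonneg[of \<gamma> 1] by (simp add: powr_powr R_def r_def)
    then have a0: "a 0 = x\<^sub>0"
      using exit_time_eq_1[of "r 0" \<gamma>] rpos[of 0] \<gamma>(4) by (simp add: a_def)
    \<comment> \<open>Both entries of the minimum in \<open>infdist_ge_after_exit\<close> are
      beaten: \<open>r (Suc k) powr s\<close> by the last entry of \<open>\<rho>\<^sub>0\<close>,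
      the endpoint term by \<open>d0 / 4\<close>.\<close>
    have far: "2 * \<rho> k < infdist (\<gamma> t) (frontier \<Omega>)" if "exit_time \<gamma> (r (Suc k)) \<le> t" "t \<le> 1" for k t
    proof -
      have "min (r (Suc k) powr s) (C\<^sub>0 * infdist (\<gamma> 1) (frontier \<Omega>)) \<le> C\<^sub>0 * infdist (\<gamma> t) (frontier \<Omega>)"
        using that rpos s jt by (intro infdist_ge_after_exit[OF \<gamma>(1)]) (auto intro: less_imp_le)
      moreover have "C\<^sub>0 * (2 * \<rho> k) < r (Suc k) powr s"
      proof -
        have "C\<^sub>0 * (2 * \<rho>\<^sub>0) \<le> R powr s * 2 powr - s / 2"
          using \<rho>0(6) C0 by (simp add: field_simps powr_minus)
        also have "\<dots> < R powr s * 2 powr - s" using R by simp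
        finally have "C\<^sub>0 * (2 * \<rho>\<^sub>0) * (2 powr - s) ^ k < R powr s * 2 powr - s * (2 powr - s) ^ k"
          using \<beta> by (intro mult_strict_right_mono) auto
        then show ?thesis
          using powr_scale_power[OF R, of "Suc k" s] by (simp add: \<rho>_def r_def mult_ac)
      qed
      moreover have "C\<^sub>0 * (2 * \<rho> k) < C\<^sub>0 * infdist (\<gamma> 1) (frontier \<Omega>)"
        using \<rho>\<rho>0[of k] \<rho>0(3) d0 C0 by (simp add: \<gamma>(4) d0_def[symmetric])
      ultimately have "C\<^sub>0 * (2 * \<rho> k) < C\<^sub>0 * infdist (\<gamma> t) (frontier \<Omega>)" by linarith
      then show ?thesis using C0 by simp
    qed
    have step: "\<bar>avg \<Omega> u (a k) (\<rho> k) - avg \<Omega> u (a (Suc k)) (\<rho> (Suc k))\<bar>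
        \<le> C\<^sub>1 * (\<kappa> * r k + \<kappa> powr (1 - p) * (\<rho> k / \<rho> k ^ DIM('a) * G k))" if "0 < \<kappa>" for \<kappa> k
      unfolding a_def C\<^sub>1_def v_def G_def
      using far[of k] rpos[of "Suc k"]
      by (intro avg_chain_step_le[OF \<Omega>(1) wg u w p \<gamma>(1,3,2) that]
          rmono \<rho>pos \<rho>le eq_refl[OF \<rho>Suc] \<rho>r) (simp_all add: less_imp_le)
    \<comment> \<open>The link from the John centre to a ball inside the cube, made within the
      convex set \<open>K\<close> instead of along the curve.\<close>
    have top: "\<bar>avg \<Omega> u c0 \<rho>\<^sub>0 - avg \<Omega> u (a 0) (\<rho> 0)\<bar>
        \<le> C\<^sub>2 * (\<kappa> * r 0 + \<kappa> powr (1 - p) * (\<rho> 0 / \<rho> 0 ^ DIM('a) * G 0))" if \<kappa>: "0 < \<kappa>" for \<kappa>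
    proof -
      have KG: "(LINT y:K|lebesgue. norm (g y) powr p) \<le> G 0"
        unfolding G_def
      proof (rule set_integral_powr_mono[OF w])
        show "\<Omega> \<inter> ball x (4 * r 0) \<in> sets lebesgue"
          using \<Omega>(1) by (auto intro!: sets_completionI_sets borel_open open_Int)
        show "K \<subseteq> \<Omega> \<inter> ball x (4 * r 0)"
        proof
          fix y assume "y \<in> K"
          then have "y \<in> \<Omega>" using K(3) by blast
          have "dist x y \<le> norm x + norm y" by (simp add: dist_norm norm_triangle_ineq4)
          also have "\<dots> \<le> B + B" using B \<open>y \<in> \<Omega>\<close> x(1) by (intro add_mono) auto
          also have "\<dots> < 4 * r 0" unfolding r_def R_def by (auto simp: max_def)
          finally show "y \<in> \<Omega> \<inter> ball x (4 * r 0)" using \<open>y \<in> \<Omega>\<close> by simp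
        qed
      qed (use fmeasurableD[OF lmeasurable_compact[OF K(1)]] in auto)
      have "\<bar>avg \<Omega> u c0 \<rho>\<^sub>0 - avg \<Omega> u x\<^sub>0 \<rho>\<^sub>0\<bar> \<le> (dist c0 x\<^sub>0 + \<bar>\<rho>\<^sub>0 - \<rho>\<^sub>0\<bar>) / \<rho>\<^sub>0 ^ DIM('a) *
        (\<kappa> * measure lebesgue K + \<kappa> powr (1 - p) * (LINT x:K|lebesgue. norm (g x) powr p))"
        using K(4)[OF c0(2)] K(4)[OF Q(3)] subset_cball[OF \<rho>0(4)] \<rho>0(1)
        by (intro avg_diff_le_Lp[OF wg u w p K(1-3) _ _ _ _ _ \<kappa>]) (blast | simp)+
      also have "\<dots> \<le> dist c0 x\<^sub>0 / \<rho>\<^sub>0 ^ DIM('a) * (\<kappa> * measure lebesgue K + \<kappa> powr (1 - p) * G 0)"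
        using KG \<rho>0(1) by (auto intro!: mult_left_mono divide_right_mono add_mono)
      also have "\<dots> \<le> dist c0 x\<^sub>0 / \<rho>\<^sub>0 ^ DIM('a) * ((measure lebesgue K / R + \<rho>\<^sub>0 ^ DIM('a) / \<rho>\<^sub>0) *
          (\<kappa> * R + \<kappa> powr (1 - p) * (\<rho>\<^sub>0 / \<rho>\<^sub>0 ^ DIM('a) * G 0)))"
      proof (rule mult_left_mono)
        have G0: "0 \<le> G 0"
          unfolding G_def set_lebesgue_integral_def by (intro Bochner_Integration.integral_nonneg) auto
        have "(measure lebesgue K / R + \<rho>\<^sub>0 ^ DIM('a) / \<rho>\<^sub>0) * (\<kappa> * R + \<kappa> powr (1 - p) * (\<rho>\<^sub>0 / \<rho>\<^sub>0 ^ DIM('a) * G 0))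
          = (\<kappa> * measure lebesgue K + \<kappa> powr (1 - p) * G 0) +
            (measure lebesgue K / R * (\<kappa> powr (1 - p) * (\<rho>\<^sub>0 / \<rho>\<^sub>0 ^ DIM('a) * G 0)) + \<rho>\<^sub>0 ^ DIM('a) / \<rho>\<^sub>0 * (\<kappa> * R))"
          using R \<rho>0(1) by (simp add: field_simps)
        moreover have "0 \<le> measure lebesgue K / R * (\<kappa> powr (1 - p) * (\<rho>\<^sub>0 / \<rho>\<^sub>0 ^ DIM('a) * G 0)) + \<rho>\<^sub>0 ^ DIM('a) / \<rho>\<^sub>0 * (\<kappa> * R)"
          using R \<rho>0(1) G0 \<kappa> by auto
        ultimately show "\<kappa> * measure lebesgue K + \<kappa> powr (1 - p) * G 0 \<le>
          (measure lebesgue K / R + \<rho>\<^sub>0 ^ DIM('a) / \<rho>\<^sub>0) * (\<kappa> * R + \<kappa> powr (1 - p) * (\<rho>\<^sub>0 / \<rho>\<^sub>0 ^ DIM('a) * G 0))"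
          by linarith
      qed (use \<rho>0(1) in auto)
      finally show ?thesis
        unfolding a0 by (simp add: C\<^sub>2_def r_def \<rho>_def mult.assoc)
    qed
    have "V \<le> avg \<Omega> u c0 \<rho>\<^sub>0"
    proof -
      have "cball c0 \<rho>\<^sub>0 \<subseteq> Q" using c0(3) subset_cball[OF \<rho>0(5)] by blast
      then have "cball c0 \<rho>\<^sub>0 \<subseteq> \<Omega>" "\<And>y. y \<in> cball c0 \<rho>\<^sub>0 \<Longrightarrow> 1 \<le> u y" using Q(2) uQ by blast+
      then show ?thesis
        using avg_ge[OF u \<rho>0(1), of c0 1] by (simp add: V_def)
    qed
    \<comment> \<open>By continuity \<open>u\<close> is below 1/4 near \<open>x\<close>, and for
      small \<open>r N\<close> the ball about \<open>a N\<close> lies in that neighbourhood.\<close>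
    moreover have "\<exists>N. avg \<Omega> u (a N) (\<rho> N) \<le> V / 4"
    proof -
      obtain d where d: "0 < d" "\<And>y. y \<in> \<Omega> \<Longrightarrow> dist y x < d \<Longrightarrow> dist (u y) (u x) < 1 / 4"
        using u x(1) unfolding continuous_on_iff by (metis zero_less_divide_1_iff zero_less_numeral)
      have "r \<longlonglongrightarrow> 0"
        unfolding r_def by (rule LIMSEQ_divide_realpow_zero) simp
      then have "\<forall>\<^sub>F k in sequentially. r k < d / 2" using d(1) by (intro order_tendstoD) auto
      then obtain N where N: "r N < d / 2" by (auto simp: eventually_sequentially)
      have T: "exit_time \<gamma> (r (Suc N)) \<le> exit_time \<gamma> (r N)" "0 \<le> exit_time \<gamma> (r N)" "exit_time \<gamma> (r N) \<le> 1"
        using exit_time_bounds[of "r N" \<gamma>] exit_time_mono[of "r (Suc N)" "r N" \<gamma>]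
          rpos[of N] rpos[of "Suc N"] rmono[of N] by simp_all
      have "a N \<in> \<Omega>" using \<gamma>(2) T by (auto simp: a_def path_image_def)
      then have sub: "cball (a N) (\<rho> N) \<subseteq> \<Omega>"
        using far[of N "exit_time \<gamma> (r N)"] T \<rho>pos[of N]
        by (intro cball_subset_of_infdist_frontier) (auto simp: a_def)
      have "dist x (a N) \<le> r N"
        using dist_le_until_exit[OF \<gamma>(1), of "r N" "exit_time \<gamma> (r N)"] rpos[of N] T by (simp add: a_def \<gamma>(3))
      then have "u y \<le> 1 / 4" if "y \<in> cball (a N) (\<rho> N)" for y
      proof -
        have "dist y x \<le> dist (a N) y + dist x (a N)" by (metis dist_commute dist_triangle2 add.commute)
        also have "\<dots> \<le> r N + r N" using that \<rho>r[of N] \<open>dist x (a N) \<le> r N\<close> by (intro add_mono) auto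
        finally have "dist (u y) (u x) < 1 / 4" using N sub that by (intro d) auto
        then show ?thesis using x(2) unfolding dist_real_def by linarith
      qed
      from avg_le[OF u \<rho>pos sub this] show ?thesis by (auto simp: V_def)
    qed
    ultimately show "\<exists>k. \<delta> * (R / 2 ^ k) powr \<alpha> \<le>
        (LINT y:\<Omega> \<inter> ball x (4 * (R / 2 ^ k))|lebesgue. norm (g y) powr p)"
      using \<delta>(2)[rule_format, of "avg \<Omega> u c0 \<rho>\<^sub>0" "\<lambda>k. avg \<Omega> u (a k) (\<rho> k)" G] step top
      unfolding G_def r_def by blast
  qed
qed

section \<open>Covering argument\<close>

text \<open>The definition of the content asks for a sequence of balls with positive radii. The
  finite cover is padded by balls with arbitrary centres whose radii have \<open>q\<close>-th powers
  of total at most \<open>e\<close>.\<close>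

lemma hausdorff_content_le_sum:
  fixes E :: "'a::metric_space set"
  assumes I: "finite I" and r: "\<And>i. i \<in> I \<Longrightarrow> 0 < r i" and E: "E \<subseteq> (\<Union>i\<in>I. ball (x i) (r i))" and q: "0 < q"
  shows "hausdorff_content q E \<le> ennreal (\<Sum>i\<in>I. r i powr q)"
proof (rule ennreal_le_epsilon)
  fix e :: real assume e: "0 < e"
  obtain h where h: "bij_betw h {..<card I} I"
    using ex_bij_betw_nat_finite[OF I] by (auto simp: atLeast0LessThan)
  define X where "X i = (if i < card I then x (h i) else undefined)" for i
  define \<rho> where "\<rho> i = (if i < card I then r (h i) else (e * (1 / 2) ^ Suc i) powr (1 / q))" for i
  \<comment> \<open>A majorant of \<open>\<rho> i powr q\<close>: adding the geometric term at every
    index makes its sum explicit.\<close>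
  define f where "f i = (if i < card I then r (h i) powr q else 0) + e * (1 / 2) ^ Suc i" for i
  have hI: "h i \<in> I" if "i < card I" for i using h that by (auto simp: bij_betw_def)
  have \<rho>: "0 < \<rho> i" for i using r hI e by (auto simp: \<rho>_def)
  have "(\<lambda>i. if i \<in> {..<card I} then r (h i) powr q else 0) sums (\<Sum>i<card I. r (h i) powr q)"
    by (rule sums_If_finite_set) simp
  from sums_add[OF this sums_mult[OF power_half_series, of e]]
  have f: "f sums ((\<Sum>i<card I. r (h i) powr q) + e)"
    by (simp add: f_def[abs_def])
  have "E \<subseteq> (\<Union>i. ball (X i) (\<rho> i))"
  proof
    fix y assume "y \<in> E"
    then obtain i where i: "i \<in> I" "y \<in> ball (x i) (r i)" using E by blast
    have "i \<in> h ` {..<card I}" using bij_betw_imp_surj_on[OF h] i(1) by simp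
    then obtain j where "j < card I" "h j = i" by blast
    then have "y \<in> ball (X j) (\<rho> j)" using i by (simp add: X_def \<rho>_def)
    then show "y \<in> (\<Union>i. ball (X i) (\<rho> i))" by blast
  qed
  then have "hausdorff_content q E \<le> (\<Sum>i. ennreal (\<rho> i powr q))"
    unfolding hausdorff_content_def using \<rho> by (intro INF_lower2[of "(X, \<rho>)"]) auto
  also have "\<dots> \<le> (\<Sum>i. ennreal (f i))"
  proof (intro suminf_le ennreal_leI summableI)
    show "\<rho> i powr q \<le> f i" for i
      using e q by (auto simp: \<rho>_def f_def powr_powr)
  qed
  also have "\<dots> = ennreal (\<Sum>i. f i)"
    using e by (intro suminf_ennreal2 sums_summable[OF f]) (auto simp: f_def)
  also have "(\<Sum>i. f i) = (\<Sum>i\<in>I. r i powr q) + e"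
    using sums_unique[OF f] sum.reindex_bij_betw[OF h, of "\<lambda>i. r i powr q"] by simp
  finally show "hausdorff_content q E \<le> ennreal (\<Sum>i\<in>I. r i powr q) + ennreal e"
    using e by (simp add: sum_nonneg)
qed

text \<open>One factor \<open>a i\<close> is kept, and in the remaining power \<open>e - 1\<close>
  it is replaced by the whole sum.\<close>

lemma sum_powr_le_powr_sum:
  fixes a :: "'i \<Rightarrow> real"
  assumes "finite I" "\<And>i. i \<in> I \<Longrightarrow> 0 \<le> a i" "1 \<le> e"
  shows "(\<Sum>i\<in>I. a i powr e) \<le> (\<Sum>i\<in>I. a i) powr e"
proof -
  have split: "t powr e = t * t powr (e - 1)" if "0 \<le> t" for t :: real
    using that powr_add[of t 1 "e - 1"] by (cases "t = 0") auto
  have "(\<Sum>i\<in>I. a i powr e) \<le> (\<Sum>i\<in>I. a i * (\<Sum>i\<in>I. a i) powr (e - 1))"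
  proof (rule sum_mono)
    fix i assume i: "i \<in> I"
    have "a i \<le> (\<Sum>i\<in>I. a i)" using assms i by (intro member_le_sum) auto
    then show "a i powr e \<le> a i * (\<Sum>i\<in>I. a i) powr (e - 1)"
      using assms i by (subst split) (auto intro!: mult_left_mono powr_mono2)
  qed
  also have "\<dots> = (\<Sum>i\<in>I. a i) powr e"
    using assms by (subst split) (auto simp: sum_nonneg sum_distrib_right)
  finally show ?thesis .
qed

text \<open>Measurability is given on compact subsets; an exhaustion of \<Omega> by compact sets
  transfers it to a pointwise limit.\<close>

lemma Lp_loc_borel_measurable:
  assumes "open \<Omega>" "Lp_loc p \<Omega> g"
  shows "(\<lambda>x. indicator \<Omega> x *\<^sub>R g x) \<in> borel_measurable lebesgue"
proof -
  obtain K where K: "\<And>n. compact (K n)" "\<And>n. K n \<subseteq> \<Omega>" "\<And>n. K n \<subseteq> interior (K (Suc n))" "\<Union>(range K) = \<Omega>"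
    using open_Union_compact_subsets[OF assms(1)] by metis
  have mono: "K m \<subseteq> K n" if "m \<le> n" for m n
    using K(3) interior_subset by (intro lift_Suc_mono_le[of K, OF _ that]) blast
  show ?thesis
  proof (rule borel_measurable_LIMSEQ_metric)
    show "(\<lambda>x. indicator (K n) x *\<^sub>R g x) \<in> borel_measurable lebesgue" for n
      using assms(2) K unfolding Lp_loc_def set_borel_measurable_def by blast
    fix x
    have "\<forall>\<^sub>F n in sequentially. indicator (K n) x *\<^sub>R g x = indicator \<Omega> x *\<^sub>R g x"
    proof (cases "x \<in> \<Omega>")
      case True
      then obtain m where "x \<in> K m" using K(4) by blast
      then have "\<forall>n\<ge>m. x \<in> K n" using mono by blast
      then show ?thesis using True unfolding eventually_sequentially by (auto intro!: exI[of _ m])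
    next
      case False
      then have "x \<notin> K n" for n using K(2) by blast
      then show ?thesis using False by simp
    qed
    then show "(\<lambda>n. indicator (K n) x *\<^sub>R g x) \<longlonglongrightarrow> indicator \<Omega> x *\<^sub>R g x"
      by (rule tendsto_eventually)
  qed
qed

lemma sum_set_integral_disjoint_le:
  fixes f :: "'a \<Rightarrow> real"
  assumes F: "finite F" "disjoint_family_on S F" "\<And>i. i \<in> F \<Longrightarrow> S i \<in> sets M" "\<And>i. i \<in> F \<Longrightarrow> S i \<subseteq> A"
    and f: "set_integrable M A f" "\<And>x. 0 \<le> f x"
  shows "(\<Sum>i\<in>F. LINT x:S i|M. f x) \<le> (LINT x:A|M. f x)"
proof -
  have int: "integrable M (\<lambda>x. indicator (S i) x *\<^sub>R f x)" if "i \<in> F" for i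
    using set_integrable_subset[OF f(1)] F that unfolding set_integrable_def by blast
  have "(\<Sum>i\<in>F. LINT x:S i|M. f x) = (LINT x|M. (\<Sum>i\<in>F. indicator (S i) x *\<^sub>R f x))"
    unfolding set_lebesgue_integral_def using int by (simp add: Bochner_Integration.integral_sum)
  also have "\<dots> \<le> (LINT x|M. indicator A x *\<^sub>R f x)"
  proof (intro integral_mono Bochner_Integration.integrable_sum int)
    show "integrable M (\<lambda>x. indicator A x *\<^sub>R f x)" using f(1) by (simp add: set_integrable_def)
    fix x
    have "(\<Sum>i\<in>F. indicator (S i) x *\<^sub>R f x) = indicator (\<Union>i\<in>F. S i) x * f x"
      by (simp add: indicator_UN_disjoint[OF F(1,2)] sum_distrib_right)
    also have "\<dots> \<le> indicator A x *\<^sub>R f x"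
      using F(4) f(2)[of x] by (auto simp: indicator_def)
    finally show "(\<Sum>i\<in>F. indicator (S i) x *\<^sub>R f x) \<le> indicator A x *\<^sub>R f x" .
  qed
  finally show ?thesis by (simp add: set_lebesgue_integral_def)
qed

text \<open>Vitali's lemma selects disjoint balls of radius \<open>4 * r x\<close> whose fivefold
  dilates still cover \<open>E\<close>, whence the factor 20. Disjointness bounds the sum of their
  energies by the total energy. The density turns energies into radii, and because
  \<open>\<alpha> \<le> q\<close> the power \<open>q / \<alpha>\<close> can be taken outside the
  sum.\<close>

lemma hausdorff_content_le_of_density:
  fixes E :: "'a::euclidean_space set" and f :: "'a \<Rightarrow> real"
  assumes E: "compact E" "E \<subseteq> \<Omega>" and \<Omega>: "open \<Omega>" and f: "set_integrable lebesgue \<Omega> f" "\<And>x. 0 \<le> f x"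
    and pos: "0 < R" "0 < \<delta>" "0 < \<alpha>" "\<alpha> \<le> q"
    and dens: "\<And>x. x \<in> E \<Longrightarrow> \<exists>k. \<delta> * (R / 2 ^ k) powr \<alpha> \<le> (LINT y:\<Omega> \<inter> ball x (4 * (R / 2 ^ k))|lebesgue. f y)"
  shows "\<delta> / 20 powr \<alpha> * enn2real (hausdorff_content q E) powr (\<alpha> / q) \<le> (LINT y:\<Omega>|lebesgue. f y)"
proof -
  define T where "T = (LINT y:\<Omega>|lebesgue. f y)"
  obtain k where k: "\<And>x. x \<in> E \<Longrightarrow> \<delta> * (R / 2 ^ k x) powr \<alpha> \<le> (LINT y:\<Omega> \<inter> ball x (4 * (R / 2 ^ k x))|lebesgue. f y)"
    using dens by metis
  define r :: "'a \<Rightarrow> real" where "r x = R / 2 ^ k x" for x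
  define G where "G x = (LINT y:\<Omega> \<inter> ball x (4 * r x)|lebesgue. f y)" for x
  have r: "0 < r x" "r x \<le> R" for x
    using pos by (auto simp: r_def field_simps)
  have "E \<subseteq> (\<Union>x\<in>E. ball x (4 * r x))" using r by fastforce
  \<comment> \<open>Passing to a finite subcover first makes the Vitali family finite, so that only
    finite sums occur.\<close>
  then obtain D where D: "D \<subseteq> E" "finite D" "E \<subseteq> (\<Union>x\<in>D. ball x (4 * r x))"
    by (rule compactE_image[OF E(1) open_ball]) (rule that)
  have "\<And>x. x \<in> D \<Longrightarrow> 0 < 4 * r x \<and> 4 * r x \<le> 4 * R" using r by simp
  then obtain F where F: "F \<subseteq> D" "pairwise (\<lambda>i j. disjnt (ball i (4 * r i)) (ball j (4 * r j))) F"
    "E \<subseteq> (\<Union>i\<in>F. ball i (5 * (4 * r i)))"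
    by (rule Vitali_covering_lemma_balls[OF D(3), of "4 * R"]) (assumption, rule that)
  have finF: "finite F" using F(1) D(2) by (rule finite_subset)
  have G0: "0 \<le> G x" for x
    unfolding G_def set_lebesgue_integral_def using f(2) by (intro Bochner_Integration.integral_nonneg) auto
  have "(\<Sum>x\<in>F. G x) \<le> T"
    unfolding G_def T_def
  proof (rule sum_set_integral_disjoint_le[OF finF])
    show "disjoint_family_on (\<lambda>x. \<Omega> \<inter> ball x (4 * r x)) F"
      using F(2) unfolding pairwise_def disjnt_def disjoint_family_on_def by blast
  qed (use \<Omega> f in \<open>auto intro!: sets_completionI_sets borel_open open_Int\<close>)
  then have GT: "(\<Sum>x\<in>F. G x / \<delta>) \<le> T / \<delta>"
    using pos by (simp add: divide_right_mono flip: sum_divide_distrib)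
  have T0: "0 \<le> T" using \<open>(\<Sum>x\<in>F. G x) \<le> T\<close> sum_nonneg[of F G, OF G0] by linarith
  have piece: "(20 * r x) powr q \<le> 20 powr q * (G x / \<delta>) powr (q / \<alpha>)" if "x \<in> F" for x
  proof -
    have "r x powr \<alpha> \<le> G x / \<delta>"
      using k[of x] that F(1) D(1) pos by (auto simp: r_def G_def field_simps)
    then have "(r x powr \<alpha>) powr (q / \<alpha>) \<le> (G x / \<delta>) powr (q / \<alpha>)"
      using pos by (intro powr_mono2) auto
    then have "r x powr q \<le> (G x / \<delta>) powr (q / \<alpha>)"
      using pos by (simp add: powr_powr)
    then show ?thesis using r[of x] by (simp add: powr_mult)
  qed
  have "hausdorff_content q E \<le> ennreal (\<Sum>x\<in>F. (5 * (4 * r x)) powr q)"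
    using r pos by (intro hausdorff_content_le_sum[OF finF _ F(3)]) auto
  also have "(\<Sum>x\<in>F. (5 * (4 * r x)) powr q) \<le> (\<Sum>x\<in>F. 20 powr q * (G x / \<delta>) powr (q / \<alpha>))"
    using piece by (intro sum_mono) simp
  also have "\<dots> \<le> 20 powr q * (\<Sum>x\<in>F. G x / \<delta>) powr (q / \<alpha>)"
    unfolding sum_distrib_left[symmetric] using finF G0 pos
    by (intro mult_left_mono sum_powr_le_powr_sum) auto
  also have "\<dots> \<le> 20 powr q * (T / \<delta>) powr (q / \<alpha>)"
    using GT G0 pos by (intro mult_left_mono powr_mono2 sum_nonneg) auto
  finally have "enn2real (hausdorff_content q E) \<le> 20 powr q * (T / \<delta>) powr (q / \<alpha>)"
    by (simp add: enn2real_leI ennreal_leI)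
  then have "enn2real (hausdorff_content q E) powr (\<alpha> / q) \<le> (20 powr q * (T / \<delta>) powr (q / \<alpha>)) powr (\<alpha> / q)"
    using pos by (intro powr_mono2) auto
  also have "\<dots> = 20 powr \<alpha> * (T / \<delta>)"
    using pos T0 by (simp add: powr_mult powr_powr)
  finally show ?thesis
    using pos by (simp add: T_def field_simps)
qed

section \<open>The lower bound for the capacity\<close>

theorem theorem1p1:
  fixes \<Omega> Q\<^sub>0 :: "(real ^ 'n) set" and W :: "(real ^ 'n) set set"
    and x\<^sub>0 :: "real ^ 'n" and C\<^sub>0 s p q \<epsilon> :: real
  assumes "2 \<le> CARD('n)"
    and "1 \<le> s"
    and "s_John_domain s C\<^sub>0 x\<^sub>0 \<Omega>"
    and "whitney_decomposition \<Omega> W"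
    and "Q\<^sub>0 \<in> W" and "x\<^sub>0 \<in> Q\<^sub>0"
    and "0 < \<epsilon>" and "\<epsilon> < 1"
    and "1 \<le> p" and "p \<le> real CARD('n)"
    and "s * (real CARD('n) - 1) + 1 - p + \<epsilon> \<le> q"
  shows "\<exists>C>0. \<forall>E. compact E \<and> E \<subseteq> \<Omega> \<and> E \<inter> Q\<^sub>0 = {} \<longrightarrow>
           Cap p E Q\<^sub>0 \<Omega> \<ge>
             ennreal (C * enn2real (hausdorff_content q E)
                            powr ((s * (real CARD('n) - 1) + 1 - p + \<epsilon>) / q))"
proof -
  define \<alpha> where "\<alpha> = s * (real CARD('n) - 1) + 1 - p + \<epsilon>"
  \<comment> \<open>Together with \<open>p \<le> real CARD('n)\<close> this gives
    \<open>\<alpha> \<ge> \<epsilon>\<close>, hence positivity.\<close>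
  have "1 * (real CARD('n) - 1) \<le> s * (real CARD('n) - 1)"
    using assms(1,2) by (intro mult_right_mono) auto
  then have \<alpha>: "0 < \<alpha>" "\<alpha> \<le> q"
    using assms(7,10,11) unfolding \<alpha>_def by simp_all
  have \<Omega>: "open \<Omega>" using assms(3) by (simp add: s_John_domain_def bounded_domain_def)
  have Q: "axis_parallel_cube Q\<^sub>0" "Q\<^sub>0 \<subseteq> \<Omega>"
    using assms(4,5) unfolding whitney_decomposition_def by auto
  \<comment> \<open>The density constants are fixed before \<open>E\<close> is introduced; \<delta>
    determines the constant of the theorem, namely
    \<open>\<delta> / 20 powr \<alpha>\<close>.\<close>
  obtain R \<delta> where R: "0 < R" and \<delta>: "0 < \<delta>"
    and dens: "\<And>u g x. continuous_on \<Omega> u \<Longrightarrow> weak_gradient \<Omega> u g \<Longrightarrow>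
      set_integrable lebesgue \<Omega> (\<lambda>y. norm (g y) powr p) \<Longrightarrow> \<forall>y\<in>Q\<^sub>0. 1 \<le> u y \<Longrightarrow> x \<in> \<Omega> \<Longrightarrow> u x \<le> 0 \<Longrightarrow>
      \<exists>k. \<delta> * (R / 2 ^ k) powr \<alpha> \<le> (LINT y:\<Omega> \<inter> ball x (4 * (R / 2 ^ k))|lebesgue. norm (g y) powr p)"
    using John_density[OF assms(2,3) Q assms(6,7,9)] unfolding \<alpha>_def by auto
  have "ennreal (\<delta> / 20 powr \<alpha> * enn2real (hausdorff_content q E) powr (\<alpha> / q)) \<le> Cap p E Q\<^sub>0 \<Omega>"
    if E: "compact E" "E \<subseteq> \<Omega>" for E
    unfolding Cap_def
  proof (rule INF_greatest, clarify)
    fix u g assume u: "continuous_on \<Omega> u" "weak_gradient \<Omega> u g" "\<forall>x\<in>E. u x \<le> 0" "\<forall>x\<in>Q\<^sub>0. 1 \<le> u x"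
    define J where "J = (\<integral>\<^sup>+x\<in>\<Omega>. ennreal (norm (g x) powr p) \<partial>lebesgue)"
    have J: "J = (\<integral>\<^sup>+x. ennreal (indicator \<Omega> x *\<^sub>R norm (g x) powr p) \<partial>lebesgue)"
      unfolding J_def by (intro nn_integral_cong) (simp add: indicator_def)
    show "ennreal (\<delta> / 20 powr \<alpha> * enn2real (hausdorff_content q E) powr (\<alpha> / q)) \<le> J"
    \<comment> \<open>Infinite energy makes the bound trivial; finite energy provides the
      integrability over \<Omega> on which the density and covering estimates rest.\<close>
    proof (cases "J = \<infinity>")
      case False
      have m: "(\<lambda>x. indicator \<Omega> x *\<^sub>R g x) \<in> borel_measurable lebesgue"
        using u(2) by (intro Lp_loc_borel_measurable[OF \<Omega>, where p = 1]) (simp add: weak_gradient_def)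
      have "(\<lambda>x. norm (indicator \<Omega> x *\<^sub>R g x) powr p) \<in> borel_measurable lebesgue"
        using m by measurable
      moreover have "norm (indicator \<Omega> x *\<^sub>R g x) powr p = indicator \<Omega> x *\<^sub>R norm (g x) powr p" for x
        by (simp add: indicator_def)
      ultimately have m': "(\<lambda>x. indicator \<Omega> x *\<^sub>R norm (g x) powr p) \<in> borel_measurable lebesgue" by simp
      have int: "set_integrable lebesgue \<Omega> (\<lambda>x. norm (g x) powr p)"
        unfolding set_integrable_def
      proof (rule integrableI_nonneg[OF m'])
        show "(\<integral>\<^sup>+x. ennreal (indicator \<Omega> x *\<^sub>R norm (g x) powr p) \<partial>lebesgue) < \<infinity>"
          using False by (simp only: J less_top infinity_ennreal_def)
      qed simp
      have "\<delta> / 20 powr \<alpha> * enn2real (hausdorff_content q E) powr (\<alpha> / q) \<le> (LINT x:\<Omega>|lebesgue. norm (g x) powr p)"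
        using E u by (intro hausdorff_content_le_of_density[OF E \<Omega> int _ R \<delta> \<alpha>] dens[OF u(1,2) int u(4)]) auto
      also have "ennreal (LINT x:\<Omega>|lebesgue. norm (g x) powr p) = J"
        unfolding J set_lebesgue_integral_def
        using int by (intro nn_integral_eq_integral[symmetric]) (auto simp: set_integrable_def)
      finally show ?thesis by (simp add: ennreal_leI)
    qed simp
  qed
  then show ?thesis
    using \<delta> unfolding \<alpha>_def[symmetric] by (intro exI[of _ "\<delta> / 20 powr \<alpha>"]) auto
qed

end
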